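(* There is a square representation $\mathfrak{B}$ of $51_{65}$ such that a consistent atomic $51_{65}$-network is satisfiable in $\mathfrak{B}$ if and only if it avoids $(N,f_1)$, $(N,f_2)$, $(N,f_3)$, and $(N,f_4)$. Consequently, $\mathfrak{B}$ is a finitely bounded universal representation of $51_{65}$.
   Context: A relation algebra is an algebra $\mathbf{A}=(A;\cup,\bar{\ },0,1,\mathrm{Id},\breve{\ },\circ)$ such that, with $x\cap y:=\overline{(\bar x\cup\bar y)}$, the structure $(A;\cup,\cap,\bar{\ },0,1)$ is a Boolean algebra, $\circ$ is associative, and for all $a,b,c\in A$: $(a\cup b)\circ c=(a\circ c)\cup(b\circ c)$; $a\circ\mathrm{Id}=a$; $\breve{\breve a}=a$; $(a\cup b)\breve{\ }=\breve a\cup\breve b$; $(a\circ b)\breve{\ }=\breve b\circ\breve a$; $\bar b\cup(\breve a\circ\overline{(a\circ b)})=\bar b$. Write $a\le b$ if $a\cap b=a$. An atom is a minimal element of $A\setminus\{0\}$ with respect to $\le$. In a finite relation algebra, $\circ$ and $\breve{\ }$ are determined by their values on atoms. $51_{65}$ is the finite relation algebra with exactly four atoms $\mathrm{Id},a,b,c$, all satisfying $\breve x=x$, where $\mathrm{Id}\circ x=x\circ\mathrm{Id}=x$, where for $x,y\in\{a,b,c\}$ we have $\mathrm{Id}\le x\circ y$ iff $x=y$, and where for $x,y,z\in\{a,b,c\}$ we have $z\le x\circ y$ iff $(x,y,z)$ is neither $(a,a,a)$, nor $(c,c,c)$, nor a permutation of $(a,b,b)$ or of $(c,b,b)$. A representation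 of $\mathbf{A}$ is a relational structure $\mathfrak{B}$ with domain $B$ and a binary relation $a^{\mathfrak{B}}\subseteq B^2$ for each $a\in A$ such that for all $a,b\in A$: $0^{\mathfrak{B}}=\varnothing$; $1^{\mathfrak{B}}=\bigcup_{a\in A}a^{\mathfrak{B}}$; $\mathrm{Id}^{\mathfrak{B}}=\{(u,u)\mid u\in B\}$; $(\bar a)^{\mathfrak{B}}=1^{\mathfrak{B}}\setminus a^{\mathfrak{B}}$; $(\breve a)^{\mathfrak{B}}=\{(u,v)\mid(v,u)\in a^{\mathfrak{B}}\}$; $(a\cup b)^{\mathfrak{B}}=a^{\mathfrak{B}}\cup b^{\mathfrak{B}}$; $(a\circ b)^{\mathfrak{B}}=a^{\mathfrak{B}}\circ b^{\mathfrak{B}}$ (the usual composition of binary relations). It is square if $1^{\mathfrak{B}}=B^2$. It is finitely bounded if there is a finite family $\mathcal{F}$ of finite structures with signature $A$ such that a finite structure $\mathfrak{C}$ with signature $A$ embeds into $\mathfrak{B}$ if and only if no member of $\mathcal{F}$ embeds into $\mathfrak{C}$. An $\mathbf{A}$-network $(V,f)$ is a finite set $V$ together with a function $f\colon V^2\to A$. It is atomic if every $f(x,y)$ is an atom, and consistent if $f(x,x)\le\mathrm{Id}$ and $f(x,y)\le f(x,z)\circ f(z,y)$ for all $x,y,z\in V$. It is satisfiable in $\mathfrak{B}$ if there is $s\colon V\to B$ with $(s(x),s(y))\in f(x,y)^{\mathfrak{B}}$ for all $x,y\in V$; satisfiable if it is satisfiable in some representation of $\mathbf{A}$. A representation is universal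 if every satisfiable $\mathbf{A}$-network is satisfiable in it. Let $N=\{0,1,2,3\}$ and define four atomic $51_{65}$-networks on $N$ (all symmetric, with $f_k(i,i)=\mathrm{Id}$) by: $f_1(0,1)=f_1(1,2)=f_1(2,3)=f_1(3,0)=a$ and $f_1(0,2)=f_1(1,3)=c$; $f_2(0,1)=f_2(1,2)=f_2(2,3)=f_2(3,0)=c$ and $f_2(0,2)=f_2(1,3)=a$; $f_3(0,1)=f_3(1,2)=f_3(2,3)=a$ and $f_3(0,2)=f_3(0,3)=f_3(1,3)=c$; $f_4(0,1)=f_4(2,3)=b$, $f_4(0,2)=f_4(1,3)=a$, $f_4(0,3)=f_4(1,2)=c$. A network $(V,f)$ avoids $(N,f_k)$ if there is no $W\subseteq V$ such that $(W,f|_{W^2})$ is isomorphic to $(N,f_k)$. *)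

theory Defs
  imports Main
begin

section \<open>Relation algebras\<close>

text \<open>
  The Boolean part of a relation algebra is an instance of \<^class>\<open>boolean_algebra\<close>, so the
  elements of the algebra form a whole type; only the remaining operations are record fields.
\<close>

record 'a rel_ops =
  rel_id :: 'a
  rel_conv :: "'a \<Rightarrow> 'a"
  rel_comp :: "'a \<Rightarrow> 'a \<Rightarrow> 'a"

definition relation_algebra :: "'a::boolean_algebra rel_ops \<Rightarrow> bool" where
  "relation_algebra R \<longleftrightarrow>
     (\<forall>a b c. rel_comp R (rel_comp R a b) c = rel_comp R a (rel_comp R b c)) \<and>
     (\<forall>a b c. rel_comp R (sup a b) c = sup (rel_comp R a c) (rel_comp R b c)) \<and>
     (\<forall>a. rel_comp R a (rel_id R) = a) \<and>
     (\<forall>a. rel_conv R (rel_conv R a) = a) \<and>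
     (\<forall>a b. rel_conv R (sup a b) = sup (rel_conv R a) (rel_conv R b)) \<and>
     (\<forall>a b. rel_conv R (rel_comp R a b) = rel_comp R (rel_conv R b) (rel_conv R a)) \<and>
     (\<forall>a b. sup (- b) (rel_comp R (rel_conv R a) (- rel_comp R a b)) = - b)"

definition is_atom :: "'a::boolean_algebra \<Rightarrow> bool" where
  "is_atom a \<longleftrightarrow> a \<noteq> bot \<and> (\<forall>b. b \<noteq> bot \<and> b \<le> a \<longrightarrow> b = a)"


section \<open>Structures and representations\<close>

record ('a, 'b) rel_structure =
  universe :: "'b set"
  interp :: "'a \<Rightarrow> ('b \<times> 'b) set"

definition is_structure :: "('a, 'b) rel_structure \<Rightarrow> bool" where
  "is_structure B \<longleftrightarrow> (\<forall>a. interp B a \<subseteq> universe B \<times> universe B)"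

definition representation ::
    "'a::boolean_algebra rel_ops \<Rightarrow> ('a, 'b) rel_structure \<Rightarrow> bool" where
  "representation R B \<longleftrightarrow>
     is_structure B \<and>
     interp B bot = {} \<and>
     interp B top = (\<Union>a. interp B a) \<and>
     interp B (rel_id R) = Id_on (universe B) \<and>
     (\<forall>a. interp B (- a) = interp B top - interp B a) \<and>
     (\<forall>a. interp B (rel_conv R a) = (interp B a)\<inverse>) \<and>
     (\<forall>a b. interp B (sup a b) = interp B a \<union> interp B b) \<and>
     (\<forall>a b. interp B (rel_comp R a b) = interp B a O interp B b)"

definition square :: "('a::boolean_algebra, 'b) rel_structure \<Rightarrow> bool" where
  "square B \<longleftrightarrow> interp B top = universe B \<times> universe B"

definition embeds :: "('a, 'b) rel_structure \<Rightarrow> ('a, 'c) rel_structure \<Rightarrow> bool" where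
  "embeds C B \<longleftrightarrow>
     (\<exists>h. h ` universe C \<subseteq> universe B \<and> inj_on h (universe C) \<and>
          (\<forall>a. \<forall>u\<in>universe C. \<forall>v\<in>universe C.
             (u, v) \<in> interp C a \<longleftrightarrow> (h u, h v) \<in> interp B a))"

text \<open>
  Every finite structure, and below every finite network, has an isomorphic copy on a finite set
  of natural numbers, so ranging over finite subsets of \<^typ>\<open>nat\<close> is no restriction.
\<close>

definition finitely_bounded :: "('a, 'b) rel_structure \<Rightarrow> bool" where
  "finitely_bounded B \<longleftrightarrow>
     (\<exists>F :: ('a, nat) rel_structure set.
        finite F \<and> (\<forall>D\<in>F. is_structure D \<and> finite (universe D)) \<and>
        (\<forall>C :: ('a, nat) rel_structure. is_structure C \<and> finite (universe C) \<longrightarrow>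
           (embeds C B \<longleftrightarrow> \<not> (\<exists>D\<in>F. embeds D C))))"


section \<open>Networks\<close>

text \<open>Only the labels of pairs of elements of \<open>verts\<close> matter.\<close>

record ('a, 'v) network =
  verts :: "'v set"
  label :: "'v \<Rightarrow> 'v \<Rightarrow> 'a"

definition is_network :: "('a, 'v) network \<Rightarrow> bool" where
  "is_network N \<longleftrightarrow> finite (verts N)"

definition atomic :: "('a::boolean_algebra, 'v) network \<Rightarrow> bool" where
  "atomic N \<longleftrightarrow> (\<forall>x\<in>verts N. \<forall>y\<in>verts N. is_atom (label N x y))"

definition consistent :: "'a::boolean_algebra rel_ops \<Rightarrow> ('a, 'v) network \<Rightarrow> bool" where
  "consistent R N \<longleftrightarrow>
     (\<forall>x\<in>verts N. label N x x \<le> rel_id R) \<and>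
     (\<forall>x\<in>verts N. \<forall>y\<in>verts N. \<forall>z\<in>verts N.
        label N x y \<le> rel_comp R (label N x z) (label N z y))"

definition satisfiable_in :: "('a, 'v) network \<Rightarrow> ('a, 'b) rel_structure \<Rightarrow> bool" where
  "satisfiable_in N B \<longleftrightarrow>
     (\<exists>s. s ` verts N \<subseteq> universe B \<and>
          (\<forall>x\<in>verts N. \<forall>y\<in>verts N. (s x, s y) \<in> interp B (label N x y)))"

text \<open>
  HOL cannot quantify over types inside a formula. The type argument is the type containing the
  domains of the representations that may witness satisfiability; a theorem in which it is a
  type variable therefore speaks about representations of every cardinality.
\<close>

definition satisfiable ::
    "'c itself \<Rightarrow> 'a::boolean_algebra rel_ops \<Rightarrow> ('a, 'v) network \<Rightarrow> bool" where
  "satisfiable T R N \<longleftrightarrow>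
     (\<exists>M :: ('a, 'c) rel_structure. representation R M \<and> satisfiable_in N M)"

definition universal ::
    "'c itself \<Rightarrow> 'a::boolean_algebra rel_ops \<Rightarrow> ('a, 'b) rel_structure \<Rightarrow> bool" where
  "universal T R B \<longleftrightarrow>
     representation R B \<and>
     (\<forall>N :: ('a, nat) network. is_network N \<and> satisfiable T R N \<longrightarrow> satisfiable_in N B)"

definition avoids :: "('a, 'v) network \<Rightarrow> ('a, 'w) network \<Rightarrow> bool" where
  "avoids N P \<longleftrightarrow>
     \<not> (\<exists>W \<subseteq> verts N. \<exists>h. bij_betw h W (verts P) \<and>
          (\<forall>x\<in>W. \<forall>y\<in>W. label N x y = label P (h x) (h y)))"


section \<open>The relation algebra $51_{65}$\<close>

text \<open>
  The algebra is the power set of its four atoms; the atoms in the sense of \<^const>\<open>is_atom\<close> are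
  the singletons, and converse and composition extend additively from them.
\<close>

datatype atom51 = At_Id | At_a | At_b | At_c

fun cycle51 :: "atom51 \<Rightarrow> atom51 \<Rightarrow> atom51 \<Rightarrow> bool" \<comment> \<open>\<open>z \<le> x \<circ> y\<close>\<close> where
  "cycle51 At_Id y z \<longleftrightarrow> z = y"
| "cycle51 x At_Id z \<longleftrightarrow> z = x"
| "cycle51 x y At_Id \<longleftrightarrow> x = y"
| "cycle51 x y z \<longleftrightarrow>
     (x, y, z) \<notin> {(At_a, At_a, At_a), (At_c, At_c, At_c),
                   (At_a, At_b, At_b), (At_b, At_a, At_b), (At_b, At_b, At_a),
                   (At_c, At_b, At_b), (At_b, At_c, At_b), (At_b, At_b, At_c)}"

definition ra51_65 :: "atom51 set rel_ops" where
  "ra51_65 =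
     \<lparr>rel_id = {At_Id},
      rel_conv = (\<lambda>X. X),
      rel_comp = (\<lambda>X Y. {z. \<exists>x\<in>X. \<exists>y\<in>Y. cycle51 x y z})\<rparr>"

lemma is_atom_atom51_set: "is_atom (X :: atom51 set) \<longleftrightarrow> (\<exists>x. X = {x})"
proof
  assume X: "is_atom X"
  then obtain x where "x \<in> X" by (auto simp: is_atom_def)
  with X have "{x} = X" unfolding is_atom_def by blast
  then show "\<exists>x. X = {x}" by blast
qed (auto simp: is_atom_def)

lemma cycle51_comm: "cycle51 x y z \<longleftrightarrow> cycle51 y x z"
  by (cases x; cases y; cases z; simp)

lemma cycle51_rot: "cycle51 x y z \<longleftrightarrow> cycle51 x z y"
  by (cases x; cases y; cases z; simp)

lemma ex_atom51: "(\<exists>x. P x) \<longleftrightarrow> P At_Id \<or> P At_a \<or> P At_b \<or> P At_c"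
  by (metis atom51.exhaust)

lemma cycle51_assoc:
  "(\<exists>u. cycle51 x y u \<and> cycle51 u z w) \<longleftrightarrow> (\<exists>v. cycle51 y z v \<and> cycle51 x v w)"
  unfolding ex_atom51 by (cases x; cases y; cases z; cases w; simp)

lemma cycle51_id: "cycle51 x At_Id z \<longleftrightarrow> z = x"
  by (cases x; simp)

lemma relation_algebra_ra51_65: "relation_algebra ra51_65"
proof -
  have assoc: "rel_comp ra51_65 (rel_comp ra51_65 X Y) Z
      = rel_comp ra51_65 X (rel_comp ra51_65 Y Z)" for X Y Z
  proof -
    have "w \<in> rel_comp ra51_65 (rel_comp ra51_65 X Y) Z \<longleftrightarrow>
        (\<exists>x\<in>X. \<exists>y\<in>Y. \<exists>z\<in>Z. \<exists>u. cycle51 x y u \<and> cycle51 u z w)" for w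
      unfolding ra51_65_def by auto
    moreover have "w \<in> rel_comp ra51_65 X (rel_comp ra51_65 Y Z) \<longleftrightarrow>
        (\<exists>x\<in>X. \<exists>y\<in>Y. \<exists>z\<in>Z. \<exists>v. cycle51 y z v \<and> cycle51 x v w)" for w
      unfolding ra51_65_def by auto
    ultimately show ?thesis unfolding cycle51_assoc by blast
  qed
  have "rel_comp ra51_65 X (- rel_comp ra51_65 X Y) \<subseteq> - Y" for X Y
    unfolding ra51_65_def by auto (metis cycle51_rot)
  then have residual: "- Y \<union> rel_comp ra51_65 X (- rel_comp ra51_65 X Y) = - Y" for X Y
    by blast
  have comm: "rel_comp ra51_65 X Y = rel_comp ra51_65 Y X" for X Y
    unfolding ra51_65_def by auto (metis cycle51_comm)+
  have conv: "rel_conv ra51_65 X = X" for X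
    unfolding ra51_65_def by simp
  have distrib: "rel_comp ra51_65 (X \<union> Y) Z
      = rel_comp ra51_65 X Z \<union> rel_comp ra51_65 Y Z" for X Y Z
    unfolding ra51_65_def by auto
  have id: "rel_comp ra51_65 X (rel_id ra51_65) = X" for X
    unfolding ra51_65_def by (auto simp: cycle51_id)
  show ?thesis
    unfolding relation_algebra_def conv
    by (intro conjI allI assoc distrib id residual comm refl)
qed


section \<open>The forbidden networks\<close>

text \<open>The argument labels two-element vertex sets, so the resulting network is symmetric.\<close>

definition sym_network4 :: "(nat set \<Rightarrow> atom51) \<Rightarrow> (atom51 set, nat) network" where
  "sym_network4 g =
     \<lparr>verts = {0, 1, 2, 3}, label = (\<lambda>x y. if x = y then {At_Id} else {g {x, y}})\<rparr>"

definition net1 :: "(atom51 set, nat) network" where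
  "net1 = sym_network4 (\<lambda>e. if e \<in> {{0, 1}, {1, 2}, {2, 3}, {3, 0}} then At_a else At_c)"

definition net2 :: "(atom51 set, nat) network" where
  "net2 = sym_network4 (\<lambda>e. if e \<in> {{0, 1}, {1, 2}, {2, 3}, {3, 0}} then At_c else At_a)"

definition net3 :: "(atom51 set, nat) network" where
  "net3 = sym_network4 (\<lambda>e. if e \<in> {{0, 1}, {1, 2}, {2, 3}} then At_a else At_c)"

definition net4 :: "(atom51 set, nat) network" where
  "net4 = sym_network4
     (\<lambda>e. if e \<in> {{0, 1}, {2, 3}} then At_b else if e \<in> {{0, 2}, {1, 3}} then At_a else At_c)"

definition satisfies_exactly_avoiding :: "(atom51 set, 'b) rel_structure \<Rightarrow> bool" where
  "satisfies_exactly_avoiding M \<longleftrightarrow>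
     (\<forall>N :: (atom51 set, nat) network.
        is_network N \<and> atomic N \<and> consistent ra51_65 N \<longrightarrow>
        (satisfiable_in N M \<longleftrightarrow>
           avoids N net1 \<and> avoids N net2 \<and> avoids N net3 \<and> avoids N net4))"

end

theory Submission
  imports "HOL-Analysis.Continuum_Not_Denumerable" Defs
begin

text \<open>
  Since \<open>b\<close> composed with itself is contained in \<open>b \<union> Id\<close>, the relation
  \<open>b \<union> Id\<close> is an equivalence relation, and vertices of different classes are joined by
  \<open>a\<close> or \<open>c\<close>. The networks \<open>f\<^sub>1\<close>, \<open>f\<^sub>2\<close>, \<open>f\<^sub>3\<close> are the consistent ways to have
  four classes. With at most three classes, coloured by the integers modulo 3, let
  \<open>x < y\<close> if either \<open>x\<close> and \<open>y\<close> are joined by \<open>a\<close> and the colour of \<open>y\<close> succeeds that of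
  \<open>x\<close>, or they are joined by \<open>c\<close> and the colour of \<open>x\<close> succeeds that of \<open>y\<close>. The absence of
  triangles \<open>aaa\<close> and \<open>ccc\<close> excludes cycles of length 3, the absence of \<open>f\<^sub>4\<close> those of
  length 4, and longer cycles have chords. So the avoiding networks are those that
  embed into a countable linear order with three dense colours, which is the representation.
  Conversely, in any representation a few composition witnesses show that \<open>f\<^sub>1, \<dots>, f\<^sub>4\<close>
  do not occur, which gives universality.
\<close>

section \<open>Atoms in representations\<close>

context
  fixes M :: "(atom51 set, 'v) rel_structure"
  assumes rep: "representation ra51_65 M"
begin

lemma interp_union: "interp M (X \<union> Y) = interp M X \<union> interp M Y"
  using rep by (simp add: representation_def)

lemma interp_compl: "interp M (- X) = interp M UNIV - interp M X"
  using rep by (simp add: representation_def)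

lemma interp_mono: "X \<subseteq> Y \<Longrightarrow> interp M X \<subseteq> interp M Y"
  by (metis interp_union sup.absorb_iff2 sup_ge1)

lemma interp_Id: "(u, v) \<in> interp M {At_Id} \<longleftrightarrow> u = v \<and> u \<in> universe M"
proof -
  have "interp M {At_Id} = Id_on (universe M)"
    using rep by (simp add: representation_def ra51_65_def)
  then show ?thesis by (auto simp: Id_on_iff)
qed

lemma interp_sym: "(u, v) \<in> interp M X \<longleftrightarrow> (v, u) \<in> interp M X"
proof -
  have "interp M X = (interp M X)\<inverse>"
    using rep by (simp add: representation_def ra51_65_def)
  then show ?thesis by blast
qed

text \<open>There are only four atoms, so every element is a finite join of them, and additivity for
  binary joins, started at \<open>bot\<close>, is enough.\<close>

lemma interp_atoms: "(u, v) \<in> interp M X \<longleftrightarrow> (\<exists>x\<in>X. (u, v) \<in> interp M {x})"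
proof -
  have "x \<in> {At_Id, At_a, At_b, At_c}" for x
    by (cases x) simp_all
  then have "X \<subseteq> {At_Id, At_a, At_b, At_c}"
    by (rule subsetI)
  then have "finite X"
    by (rule finite_subset) simp
  then show ?thesis
  proof (induction X)
    case empty
    have "interp M bot = {}" using rep unfolding representation_def by (elim conjE)
    then show ?case by simp
  next
    case (insert x X)
    have "interp M (insert x X) = interp M {x} \<union> interp M X"
      using interp_union[of "{x}" X] by simp
    with insert.IH show ?case by simp
  qed
qed

text \<open>Otherwise \<open>{x}\<close> lies below the complement of \<open>X\<close>, whose
  relation is disjoint from that of \<open>X\<close>.\<close>

lemma interp_atom_unique:
  assumes "(u, v) \<in> interp M {x}" "(u, v) \<in> interp M X"
  shows "x \<in> X"
proof (rule ccontr)
  assume "x \<notin> X"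
  then have "interp M {x} \<subseteq> interp M UNIV - interp M X"
    unfolding interp_compl[symmetric] by (intro interp_mono) auto
  with assms show False by blast
qed

text \<open>This is read in three ways below: an edge yields a middle vertex, two edges yield an
  allowed third label, and three edges form an allowed cycle.\<close>

lemma interp_comp: "interp M {z. cycle51 x y z} = interp M {x} O interp M {y}"
proof -
  have "interp M (rel_comp ra51_65 {x} {y}) = interp M {x} O interp M {y}"
    using rep by (simp add: representation_def)
  then show ?thesis by (simp add: ra51_65_def)
qed

lemma interp_witness:
  assumes "(u, v) \<in> interp M {z}" "cycle51 x y z"
  obtains w where "(u, w) \<in> interp M {x}" "(w, v) \<in> interp M {y}"
proof -
  have "interp M {z} \<subseteq> interp M {x} O interp M {y}"
    unfolding interp_comp[symmetric] using assms(2) by (intro interp_mono) simp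
  with assms(1) have "(u, v) \<in> interp M {x} O interp M {y}" by (rule subsetD[rotated])
  then show thesis by (rule relcompEpair) (rule that)
qed

lemma interp_trans:
  assumes "(u, w) \<in> interp M {x}" "(w, v) \<in> interp M {y}"
  obtains z where "(u, v) \<in> interp M {z}" "cycle51 x y z"
proof -
  have "(u, v) \<in> interp M {z. cycle51 x y z}"
    unfolding interp_comp using assms by (rule relcompI)
  then obtain z where "z \<in> {z. cycle51 x y z}" "(u, v) \<in> interp M {z}"
    unfolding interp_atoms[of u v "{z. cycle51 x y z}"] ..
  then show thesis by (intro that) simp_all
qed

lemma interp_triangle:
  assumes "(u, w) \<in> interp M {x}" "(w, v) \<in> interp M {y}" "(u, v) \<in> interp M {z}"
  shows "cycle51 x y z"
proof -
  have "(u, v) \<in> interp M {z. cycle51 x y z}"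
    unfolding interp_comp using assms(1,2) by (rule relcompI)
  with interp_atom_unique[OF assms(3)] show ?thesis by blast
qed

lemma interp_ac:
  "(u, v) \<in> interp M {At_a, At_c} \<longleftrightarrow> (\<exists>z. (z = At_a \<or> z = At_c) \<and> (u, v) \<in> interp M {z})"
  unfolding interp_atoms[of u v "{At_a, At_c}"] by auto

text \<open>Composing the join of \<open>At_a\<close> and \<open>At_c\<close> with
  \<open>At_b\<close> on either side gives that join again, so both ends may move inside their
  classes.\<close>

lemma move_within_class:
  assumes "(q, r) \<in> interp M {At_a, At_c}"
    and "(q', q) \<in> interp M {At_b}" "(r, r') \<in> interp M {At_b}"
  shows "(q', r') \<in> interp M {At_a, At_c}"
proof -
  obtain z where z: "z = At_a \<or> z = At_c" "(q, r) \<in> interp M {z}"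
    using assms(1) unfolding interp_ac by (elim exE conjE)
  obtain y where y: "(q', r) \<in> interp M {y}" "cycle51 At_b z y"
    by (rule interp_trans[OF assms(2) z(2)])
  obtain x where x: "(q', r') \<in> interp M {x}" "cycle51 y At_b x"
    by (rule interp_trans[OF y(1) assms(3)])
  have "x = At_a \<or> x = At_c"
    using z(1) y(2) x(2) by (cases x; cases y; auto)
  with x(1) show ?thesis unfolding interp_ac by (intro exI[of _ x]) simp
qed

text \<open>
  A vertex has an \<^term>\<open>At_a\<close>-neighbour in each of the three other classes, and these
  neighbours would form a triangle with all sides \<^term>\<open>At_c\<close>.
\<close>

lemma no_four_classes:
  assumes p: "(p, q) \<in> interp M {At_a, At_c}" "(p, r) \<in> interp M {At_a, At_c}"
      "(p, s) \<in> interp M {At_a, At_c}"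
    and "(q, r) \<in> interp M {At_a, At_c}" "(q, s) \<in> interp M {At_a, At_c}"
      "(r, s) \<in> interp M {At_a, At_c}"
  shows False
proof -
  have move: "\<exists>v'. (p, v') \<in> interp M {At_a} \<and> (v', v) \<in> interp M {At_b}"
    if v: "(p, v) \<in> interp M {At_a, At_c}" for v
  proof -
    obtain z where z: "z = At_a \<or> z = At_c" "(p, v) \<in> interp M {z}"
      using v unfolding interp_ac by (elim exE conjE)
    \<comment> \<open>The cycles \<open>aab\<close> and \<open>abc\<close> are both allowed, so
      whichever label joins \<open>p\<close> to \<open>v\<close>, the class of \<open>v\<close>
      contains an \<open>At_a\<close>-neighbour of \<open>p\<close>.\<close>
    then have "cycle51 At_a At_b z" by auto
    with z(2) obtain v' where "(p, v') \<in> interp M {At_a}" "(v', v) \<in> interp M {At_b}"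
      by (rule interp_witness)
    then show ?thesis by (intro exI conjI)
  qed
  have c: "(v', w') \<in> interp M {At_c}"
    if vw: "(v, w) \<in> interp M {At_a, At_c}"
      and v': "(p, v') \<in> interp M {At_a}" "(v', v) \<in> interp M {At_b}"
      and w': "(p, w') \<in> interp M {At_a}" "(w', w) \<in> interp M {At_b}" for v w v' w'
  proof -
    have "(v', w') \<in> interp M {At_a, At_c}"
      by (rule move_within_class[OF vw v'(2) w'(2)[THEN interp_sym[THEN iffD1]]])
    then obtain z where z: "z = At_a \<or> z = At_c" "(v', w') \<in> interp M {z}"
      unfolding interp_ac by (elim exE conjE)
    have "cycle51 At_a z At_a"
      by (rule interp_triangle[OF v'(1) z(2) w'(1)])
    with z show ?thesis by auto
  qed
  obtain q' where q': "(p, q') \<in> interp M {At_a}" "(q', q) \<in> interp M {At_b}"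
    using move[OF p(1)] by (elim exE conjE)
  obtain r' where r': "(p, r') \<in> interp M {At_a}" "(r', r) \<in> interp M {At_b}"
    using move[OF p(2)] by (elim exE conjE)
  obtain s' where s': "(p, s') \<in> interp M {At_a}" "(s', s) \<in> interp M {At_b}"
    using move[OF p(3)] by (elim exE conjE)
  have "cycle51 At_c At_c At_c"
    by (rule interp_triangle[OF c[OF assms(4) q' r'] c[OF assms(6) r' s'] c[OF assms(5) q' s']])
  then show False by simp
qed

text \<open>Since \<open>At_a\<close> is below \<open>At_c\<close> composed with itself,
  \<open>p\<close> and \<open>r\<close> have a common \<open>At_c\<close>-neighbour
  \<open>z\<close>. The \<open>At_b\<close>-edges carry this over: \<open>z\<close> is joined to
  \<open>q\<close> and \<open>s\<close> by \<open>At_a\<close> or \<open>At_c\<close>. The triangles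
  \<open>q z r\<close> and \<open>p z s\<close> rule out \<open>At_c\<close>, and then
  \<open>q z s\<close> has all sides \<open>At_a\<close>.\<close>

lemma no_alternating_square:
  assumes b: "(p, q) \<in> interp M {At_b}" "(r, s) \<in> interp M {At_b}"
    and a: "(p, r) \<in> interp M {At_a}" "(q, s) \<in> interp M {At_a}"
    and c: "(p, s) \<in> interp M {At_c}" "(q, r) \<in> interp M {At_c}"
  shows False
proof -
  obtain z where z: "(p, z) \<in> interp M {At_c}" "(z, r) \<in> interp M {At_c}"
    by (rule interp_witness[OF a(1), of At_c At_c]) simp
  obtain x where x: "(q, z) \<in> interp M {x}" "cycle51 At_b At_c x"
    by (rule interp_trans[OF b(1)[THEN interp_sym[THEN iffD1]] z(1)])
  obtain y where y: "(z, s) \<in> interp M {y}" "cycle51 At_c At_b y"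
    by (rule interp_trans[OF z(2) b(2)])
  have "cycle51 x At_c At_c"
    by (rule interp_triangle[OF x(1) z(2) c(2)])
  moreover have "cycle51 At_c y At_c"
    by (rule interp_triangle[OF z(1) y(1) c(1)])
  moreover have "cycle51 x y At_a"
    by (rule interp_triangle[OF x(1) y(1) a(2)])
  ultimately show False
    using x(2) y(2) by (cases x; cases y; auto)
qed

end

section \<open>Occurrences of the forbidden networks as labelled quadruples\<close>

lemma not_avoids_sym_network4E:
  assumes "\<not> avoids N (sym_network4 g)"
  obtains p q r s where "{p, q, r, s} \<subseteq> verts N"
    "label N p q = {g {0, 1}}" "label N p r = {g {0, 2}}" "label N p s = {g {0, 3}}"
    "label N q r = {g {1, 2}}" "label N q s = {g {1, 3}}" "label N r s = {g {2, 3}}"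
proof -
  obtain W h where W: "W \<subseteq> verts N" and h: "bij_betw h W {0, 1, 2, 3}"
    and l: "\<And>x y. x \<in> W \<Longrightarrow> y \<in> W \<Longrightarrow>
      label N x y = (if h x = h y then {At_Id} else {g {h x, h y}})"
    using assms unfolding avoids_def by (auto simp: sym_network4_def)
  have "\<exists>x\<in>W. h x = i" if "i \<in> {0, 1, 2, 3}" for i
    using h that unfolding bij_betw_def by (metis imageE)
  then obtain p q r s where "p \<in> W" "h p = 0" "q \<in> W" "h q = 1" "r \<in> W" "h r = 2"
    "s \<in> W" "h s = 3" by (metis insertCI)
  with W l show thesis by (intro that[of p q r s]) auto
qed

text \<open>The four vertices are distinct because equal ones would be labelled
  \<open>{At_Id}\<close>, a value that \<open>g\<close> excludes on all six edges; numbering them is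
  then the required bijection.\<close>

lemma not_avoids_sym_network4I:
  assumes V: "{p, q, r, s} \<subseteq> verts N"
    and refl: "\<And>x. x \<in> {p, q, r, s} \<Longrightarrow> label N x x = {At_Id}"
    and sym: "\<And>x y. x \<in> {p, q, r, s} \<Longrightarrow> y \<in> {p, q, r, s} \<Longrightarrow> label N x y = label N y x"
    and l: "label N p q = {g {0, 1}}" "label N p r = {g {0, 2}}" "label N p s = {g {0, 3}}"
      "label N q r = {g {1, 2}}" "label N q s = {g {1, 3}}" "label N r s = {g {2, 3}}"
    and g: "At_Id \<notin> g ` {{0, 1}, {0, 2}, {0, 3}, {1, 2}, {1, 3}, {2, 3}}"
  shows "\<not> avoids N (sym_network4 g)"
proof -
  have distinct: "p \<noteq> q" "p \<noteq> r" "p \<noteq> s" "q \<noteq> r" "q \<noteq> s" "r \<noteq> s"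
    using l g refl by auto
  define h :: "_ \<Rightarrow> nat" where
    "h x = (if x = p then 0 else if x = q then 1 else if x = r then 2 else 3)" for x
  have h: "h p = 0" "h q = 1" "h r = 2" "h s = 3"
    using distinct by (auto simp: h_def)
  have "bij_betw h {p, q, r, s} {0, 1, 2, 3}"
    unfolding bij_betw_def inj_on_def using h by auto
  moreover have "label N q p = {g {0, 1}}" "label N r p = {g {0, 2}}" "label N s p = {g {0, 3}}"
      "label N r q = {g {1, 2}}" "label N s q = {g {1, 3}}" "label N s r = {g {2, 3}}"
    using l sym by (metis insertCI)+
  then have "label N x y = label (sym_network4 g) (h x) (h y)"
    if "x \<in> {p, q, r, s}" "y \<in> {p, q, r, s}" for x y
    using that refl l unfolding sym_network4_def
    by (auto simp: h insert_commute)
  moreover have "verts (sym_network4 g) = {0, 1, 2, 3}"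
    by (simp add: sym_network4_def)
  ultimately show ?thesis
    unfolding avoids_def using V by metis
qed

text \<open>The first three networks have no \<open>At_b\<close>-edge, so their vertices would lie
  in four different classes; the fourth is the alternating square.\<close>

lemma satisfiable_avoids:
  assumes rep: "representation ra51_65 M" and "satisfiable_in N M"
  shows "avoids N net1 \<and> avoids N net2 \<and> avoids N net3 \<and> avoids N net4"
proof -
  obtain s where "\<forall>x\<in>verts N. \<forall>y\<in>verts N. (s x, s y) \<in> interp M (label N x y)"
    using assms(2) unfolding satisfiable_in_def by blast
  then have s: "(s x, s y) \<in> interp M (label N x y)" if "x \<in> verts N" "y \<in> verts N" for x y
    using that by blast
  have ac: "avoids N (sym_network4 g)" if g: "\<And>e. g e \<in> {At_a, At_c}" for g
  proof (rule ccontr)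
    assume "\<not> avoids N (sym_network4 g)"
    then obtain x y z w where V: "{x, y, z, w} \<subseteq> verts N" and l:
      "label N x y = {g {0, 1}}" "label N x z = {g {0, 2}}" "label N x w = {g {0, 3}}"
      "label N y z = {g {1, 2}}" "label N y w = {g {1, 3}}" "label N z w = {g {2, 3}}"
      by (rule not_avoids_sym_network4E)
    have *: "(s u, s v) \<in> interp M {At_a, At_c}"
      if "u \<in> verts N" "v \<in> verts N" "label N u v = {g e}" for u v e
      using interp_mono[OF rep, of "{g e}" "{At_a, At_c}"] s[OF that(1,2)] that(3) g[of e] by auto
    show False
      using V l by (intro no_four_classes[OF rep, of "s x" "s y" "s z" "s w"])
        (rule *; simp)+
  qed
  have "avoids N net1" "avoids N net2" "avoids N net3"
    unfolding net1_def net2_def net3_def by (intro ac; simp)+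
  moreover have "avoids N net4"
  proof (rule ccontr)
    assume "\<not> avoids N net4"
    then obtain x y z w where "{x, y, z, w} \<subseteq> verts N" and
      "label N x y = {At_b}" "label N x z = {At_a}" "label N x w = {At_c}"
      "label N y z = {At_c}" "label N y w = {At_a}" "label N z w = {At_b}"
      unfolding net4_def by (elim not_avoids_sym_network4E) (simp add: doubleton_eq_iff)
    then show False
      using s by (intro no_alternating_square[OF rep, of "s x" "s y" "s z" "s w"])
        (metis insert_subset)+
  qed
  ultimately show ?thesis by blast
qed

section \<open>The representation\<close>

text \<open>Converse is the identity of this algebra and the other operations are determined on
  atoms. The two directions of \<open>comp\<close> say that all allowed witnesses exist and that all
  triangles are allowed.\<close>

lemma representation_of_labelling:
  fixes l :: "'v \<Rightarrow> 'v \<Rightarrow> atom51"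
  assumes id: "\<And>u v. l u v = At_Id \<longleftrightarrow> u = v"
    and sym: "\<And>u v. l u v = l v u"
    and comp: "\<And>u v x y. cycle51 x y (l u v) \<longleftrightarrow> (\<exists>w. l u w = x \<and> l w v = y)"
  shows "representation ra51_65 \<lparr>universe = UNIV, interp = \<lambda>X. {(u, v). l u v \<in> X}\<rparr>"
proof -
  have "(u, v) \<in> {(u, v). l u v \<in> {z. \<exists>x\<in>X. \<exists>y\<in>Y. cycle51 x y z}} \<longleftrightarrow>
      (u, v) \<in> {(u, v). l u v \<in> X} O {(u, v). l u v \<in> Y}" for X Y u v
    by (simp add: comp relcomp_unfold) blast
  moreover have "{(u, v). l u v \<in> X}\<inverse> = {(u, v). l u v \<in> X}" for X
    using sym by (simp add: converse_unfold)
  ultimately show ?thesis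
    unfolding representation_def is_structure_def ra51_65_def
    using id by (simp add: set_eq_iff) auto
qed

section \<open>A countable order with three dense colours\<close>

text \<open>The colour classes are the translates of \<open>\<rat>\<close> by \<open>0\<close>,
  \<open>t\<close> and \<open>2 t\<close> for an irrational \<open>t\<close>: countable, dense and
  disjoint. Enumerating their union makes the natural numbers the vertices.\<close>

lemma dense_three_coloured_order:
  obtains pos :: "nat \<Rightarrow> real" and col :: "nat \<Rightarrow> nat"
  where "inj pos" "\<forall>n. col n < 3"
    "\<forall>p q. \<forall>i<3. p < q \<longrightarrow> (\<exists>n. col n = i \<and> p < pos n \<and> pos n < q)"
proof -
  obtain t :: real where t: "t \<notin> \<rat>"
  proof -
    have "(\<rat> :: real set) \<noteq> UNIV"
      using countable_rat uncountable_UNIV_real by metis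
    then show thesis using that by blast
  qed
  define P where "P i = (\<lambda>r. r + real i * t) ` \<rat>" for i
  define A where "A = (\<Union>i<3. P i)"
  have disj: "i = j" if xi: "x \<in> P i" and xj: "x \<in> P j" for x i j
  proof (rule ccontr)
    assume "i \<noteq> j"
    obtain r where r: "r \<in> \<rat>" "x = r + real i * t"
      using xi unfolding P_def by (elim imageE)
    obtain r' where r': "r' \<in> \<rat>" "x = r' + real j * t"
      using xj unfolding P_def by (elim imageE)
    \<comment> \<open>A point in two of the translates would express \<open>t\<close> as a quotient
      of rationals.\<close>
    have "(real i - real j) * t = r' - r"
      using r(2) r'(2) by (simp add: algebra_simps)
    then have "t = (r' - r) / (real i - real j)"
      using \<open>i \<noteq> j\<close> by (simp add: eq_divide_eq mult.commute)
    moreover have "(r' - r) / (real i - real j) \<in> \<rat>"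
      by (intro Rats_divide Rats_diff r(1) r'(1)) simp_all
    ultimately show False using t by simp
  qed
  have dense: "\<exists>x\<in>P i. p < x \<and> x < q" if "p < q" for p q i
  proof -
    have "p - real i * t < q - real i * t" using that by simp
    then obtain r where r: "r \<in> \<rat>" "p - real i * t < r" "r < q - real i * t"
      using Rats_dense_in_real by blast
    then have "r + real i * t \<in> P i" unfolding P_def by (intro imageI)
    then show ?thesis
      by (rule bexI[rotated]) (use r in linarith)
  qed
  have "countable (P i)" for i
    unfolding P_def using countable_rat by (rule countable_image)
  then have "countable A"
    unfolding A_def by (intro countable_UN) simp_all
  moreover have "infinite A"
  proof -
    have "P 0 \<subseteq> A" unfolding A_def by (rule UN_upper) simp
    moreover have "P 0 = \<rat>" unfolding P_def by simp
    moreover have "infinite (\<rat> :: real set)"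
    proof
      assume "finite (\<rat> :: real set)"
      then have "finite (UNIV :: rat set)"
        unfolding Rats_def by (rule finite_imageD) (simp add: inj_on_def)
      then show False by (simp add: infinite_UNIV_char_0)
    qed
    ultimately show ?thesis by (metis infinite_super)
  qed
  ultimately have bij: "bij_betw (from_nat_into A) UNIV A"
    by (rule bij_betw_from_nat_into)
  define col where "col n = (THE i. from_nat_into A n \<in> P i)" for n
  have col: "col n = i" if "from_nat_into A n \<in> P i" for n i
    unfolding col_def using that by (rule the_equality) (rule disj[OF _ that])
  show thesis
  proof (rule that[of "from_nat_into A" col]; (intro allI impI)?)
    show "inj (from_nat_into A)" using bij by (rule bij_betw_imp_inj_on)
    show "col n < 3" for n
    proof -
      have "from_nat_into A n \<in> A" by (rule bij_betwE[OF bij, rule_format]) simp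
      then obtain i where "i < 3" "from_nat_into A n \<in> P i" unfolding A_def by (elim UN_E) simp
      with col show ?thesis by simp
    qed
    show "\<exists>n. col n = i \<and> p < from_nat_into A n \<and> from_nat_into A n < q"
      if pq: "p < q" and i: "i < 3" for p q i
    proof -
      obtain x where x: "x \<in> P i" "p < x" "x < q" using dense[OF pq] by blast
      with i have "x \<in> A" unfolding A_def by (intro UN_I[of i]) simp_all
      then have "x \<in> range (from_nat_into A)"
        using bij by (simp only: bij_betw_imp_surj_on)
      then obtain n where n: "from_nat_into A n = x" by (elim rangeE) simp
      with x(1) have "col n = i" by (intro col) simp
      with x n show ?thesis by (intro exI[of _ n]) simp
    qed
  qed
qed

text \<open>
  The label of two distinct vertices with colours \<open>i\<close> and \<open>j\<close>, the
  first of which precedes the second iff \<open>before\<close>: vertices of different colours are joined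
  by \<^term>\<open>At_a\<close> iff their order agrees with the cyclic order of their colours.
\<close>

definition colour_label :: "nat \<Rightarrow> nat \<Rightarrow> bool \<Rightarrow> atom51" where
  "colour_label i j before =
     (if i = j then At_b else if (j = Suc i mod 3) = before then At_a else At_c)"

lemma colour_label_simps:
  "colour_label i i True = At_b" "colour_label i i False = At_b"
  "colour_label 0 1 True = At_a" "colour_label 0 1 False = At_c"
  "colour_label 0 2 True = At_c" "colour_label 0 2 False = At_a"
  "colour_label 1 2 True = At_a" "colour_label 1 2 False = At_c"
  "colour_label 1 0 True = At_c" "colour_label 1 0 False = At_a"
  "colour_label 2 0 True = At_a" "colour_label 2 0 False = At_c"
  "colour_label 2 1 True = At_c" "colour_label 2 1 False = At_a"
  by (simp_all add: colour_label_def)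

lemma less_3_cases: "(i::nat) < 3 \<Longrightarrow> (i = 0 \<Longrightarrow> R) \<Longrightarrow> (i = 1 \<Longrightarrow> R) \<Longrightarrow> (i = 2 \<Longrightarrow> R) \<Longrightarrow> R"
  by linarith

lemma ex_less_3: "(\<exists>k<3. P k) \<longleftrightarrow> P 0 \<or> P 1 \<or> P (2::nat)"
proof
  assume "\<exists>k<3. P k"
  then show "P 0 \<or> P 1 \<or> P 2"
    by (elim exE conjE less_3_cases) simp_all
next
  have "(0::nat) < 3" "(1::nat) < 3" "(2::nat) < 3" by simp_all
  moreover assume "P 0 \<or> P 1 \<or> P 2"
  ultimately show "\<exists>k<3. P k" by metis
qed

text \<open>Of two different colours modulo 3 exactly one succeeds the other, so exchanging the
  vertices reverses both the colour step and the order, and the label stays.\<close>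

lemma colour_label_sym:
  assumes "i < 3" "j < 3"
  shows "colour_label i j before = colour_label j i (\<not> before)"
  using assms by (elim less_3_cases; cases before; simp only: colour_label_simps simp_thms)

text \<open>The conditions on \<open>o1\<close>, \<open>o2\<close>, \<open>o3\<close> exclude the
  two cyclic orders of three vertices. With three different colours, sides \<open>aaa\<close> or
  \<open>ccc\<close> would be such a cyclic order; if a colour repeats, one or three sides are
  \<open>At_b\<close>, which is always allowed.\<close>

lemma colour_label_triangle:
  assumes "i < 3" "j < 3" "k < 3" and "o1 \<and> o2 \<longrightarrow> o3" "o3 \<longrightarrow> o1 \<or> o2"
  shows "cycle51 (colour_label i k o1) (colour_label k j o2) (colour_label i j o3)"
  using assms
  by (elim less_3_cases; cases o1; cases o2; cases o3; hypsubst;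
      simp only: colour_label_simps simp_thms; simp)

text \<open>This serves pairs with equal ends, where a witness needs only one suitable edge leaving
  the vertex.\<close>

lemma colour_label_surj:
  assumes "i < 3" "x \<noteq> At_Id"
  shows "\<exists>k<3. \<exists>before. colour_label i k before = x"
  unfolding ex_less_3 ex_bool_eq using assms
  by (elim less_3_cases; cases x; hypsubst; simp only: colour_label_simps; simp)

text \<open>A finite converse of \<open>colour_label_triangle\<close>: the comparisons found are
  ones that a linear order can realise, so density is enough to place the witness.\<close>

lemma colour_label_witness:
  assumes "i < 3" "j < 3" "x \<noteq> At_Id" "y \<noteq> At_Id" "cycle51 x y (colour_label i j o3)"
  shows "\<exists>k<3. \<exists>o1 o2. colour_label i k o1 = x \<and> colour_label k j o2 = y \<and>
    (o1 \<and> o2 \<longrightarrow> o3) \<and> (o3 \<longrightarrow> o1 \<or> o2)"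
  unfolding ex_less_3 ex_bool_eq using assms
  by (elim less_3_cases; cases x; cases y; cases o3; hypsubst;
      simp only: colour_label_simps; simp)

definition coloured_order :: "('v \<Rightarrow> real) \<Rightarrow> ('v \<Rightarrow> nat) \<Rightarrow> (atom51 set, 'v) rel_structure" where
  "coloured_order pos col =
     \<lparr>universe = UNIV,
      interp = \<lambda>X. {(u, v).
        (if u = v then At_Id else colour_label (col u) (col v) (pos u < pos v)) \<in> X}\<rparr>"

text \<open>Triangles are allowed because positions are linearly ordered. For a required witness the
  colour and the side of each end are found first; density then supplies a vertex of that colour
  there.\<close>

lemma representation_coloured_order:
  fixes pos :: "'v \<Rightarrow> real" and col :: "'v \<Rightarrow> nat"
  assumes inj: "inj pos" and col: "\<And>n. col n < 3"
    and dense: "\<And>p q i. p < q \<Longrightarrow> i < 3 \<Longrightarrow> \<exists>n. col n = i \<and> p < pos n \<and> pos n < q"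
  shows "representation ra51_65 (coloured_order pos col)"
proof -
  define l where
    "l u v = (if u = v then At_Id else colour_label (col u) (col v) (pos u < pos v))" for u v
  have order: "pos v < pos u \<longleftrightarrow> \<not> pos u < pos v" if "u \<noteq> v" for u v
    using inj that by (meson injD linorder_neqE order.asym)
  have id: "l u v = At_Id \<longleftrightarrow> u = v" for u v
    by (simp add: l_def colour_label_def)
  have sym: "l u v = l v u" for u v
    using colour_label_sym[OF col[of u] col[of v]] order[of u v] by (simp add: l_def)
  have tri: "cycle51 (l u w) (l w v) (l u v)" for u v w
  proof -
    consider "u = v" | "u = w" | "w = v" | "u \<noteq> v" "u \<noteq> w" "w \<noteq> v" by blast
    then show ?thesis
    proof cases
      case 1
      then show ?thesis using sym[of u w] id[of u u] by (cases "l u w"; simp)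
    next
      case 4
      then show ?thesis
        unfolding l_def
        by (simp, intro colour_label_triangle col) auto
    next
      case 2
      then show ?thesis using id[of u u] by simp
    next
      case 3
      then show ?thesis using id[of v v] by (simp add: cycle51_id)
    qed
  qed
  have ex: "\<exists>w. l u w = x \<and> l w v = y" if cyc: "cycle51 x y (l u v)" for x y u v
  proof -
    consider "x = At_Id" | "y = At_Id" | "x \<noteq> At_Id" "y \<noteq> At_Id" "u = v"
      | "x \<noteq> At_Id" "y \<noteq> At_Id" "u \<noteq> v" by blast
    then show ?thesis
    proof cases
      case 1
      then show ?thesis using cyc id[of u u] by (intro exI[of _ u]) simp
    next
      case 2
      then show ?thesis using cyc id[of v v] by (intro exI[of _ v]) (simp add: cycle51_id)
    next
      case 3
      then have "x = y" using cyc id[of u u] by (cases x; cases y; simp)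
      obtain k before where k: "k < 3" "colour_label (col u) k before = x"
        using colour_label_surj[OF col 3(1)] by blast
      \<comment> \<open>The offset 1 only provides a nonempty interval directly above or below
        \<open>pos u\<close>.\<close>
      obtain w where w: "col w = k" "pos w \<noteq> pos u" "pos u < pos w \<longleftrightarrow> before"
        using dense[of "pos u" "pos u + 1" k] dense[of "pos u - 1" "pos u" k] k(1)
        by (cases before) force+
      then have "l u w = x" using k by (auto simp: l_def)
      then show ?thesis using sym[of u w] 3(3) \<open>x = y\<close> by (intro exI[of _ w]) simp
    next
      case 4
      have "cycle51 x y (colour_label (col u) (col v) (pos u < pos v))"
        using cyc 4(3) by (simp add: l_def)
      then obtain k o1 o2 where k: "k < 3" "colour_label (col u) k o1 = x" "colour_label k (col v) o2 = y"
        "o1 \<and> o2 \<longrightarrow> pos u < pos v" "pos u < pos v \<longrightarrow> o1 \<or> o2"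
        using colour_label_witness[OF col col 4(1,2)] by blast
      have "\<exists>w. col w = k \<and> pos w \<noteq> pos u \<and> pos w \<noteq> pos v \<and>
          (pos u < pos w \<longleftrightarrow> o1) \<and> (pos w < pos v \<longleftrightarrow> o2)"
      proof -
        \<comment> \<open>The witness goes above both ends, below both, between \<open>u\<close> and
          \<open>v\<close>, or between \<open>v\<close> and \<open>u\<close>; the consistency of
          \<open>o1\<close> and \<open>o2\<close> with the order makes the chosen interval
          nonempty.\<close>
        consider "o1" "\<not> o2" | "\<not> o1" "o2" | "o1" "o2" "pos u < pos v" | "\<not> o1" "\<not> o2" "pos v < pos u"
          using k(4,5) order[OF 4(3)] by blast
        then show ?thesis
        proof cases
          case 1
          then show ?thesis
            using dense[of "max (pos u) (pos v)" "max (pos u) (pos v) + 1" k] k(1) by force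
        next
          case 2
          then show ?thesis
            using dense[of "min (pos u) (pos v) - 1" "min (pos u) (pos v)" k] k(1) by force
        next
          case 3
          then show ?thesis using dense[of "pos u" "pos v" k] k(1) by force
        next
          case 4
          then show ?thesis using dense[of "pos v" "pos u" k] k(1) by force
        qed
      qed
      then obtain w where "col w = k" "pos w \<noteq> pos u" "pos w \<noteq> pos v"
          "pos u < pos w \<longleftrightarrow> o1" "pos w < pos v \<longleftrightarrow> o2" by blast
      then have "l u w = x \<and> l w v = y" using k by (auto simp: l_def)
      then show ?thesis ..
    qed
  qed
  have comp: "cycle51 x y (l u v) \<longleftrightarrow> (\<exists>w. l u w = x \<and> l w v = y)" for x y u v
  proof
    assume "\<exists>w. l u w = x \<and> l w v = y"
    then obtain w where "l u w = x" "l w v = y" by (elim exE conjE)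
    with tri[of u w v] show "cycle51 x y (l u v)" by simp
  qed (rule ex)
  have "representation ra51_65 \<lparr>universe = UNIV, interp = \<lambda>X. {(u, v). l u v \<in> X}\<rparr>"
    using id sym comp by (rule representation_of_labelling)
  then show ?thesis unfolding coloured_order_def l_def .
qed

section \<open>Embedding networks\<close>

text \<open>Going round three different colours, the steps are all to the successor or all to the
  predecessor, so the labels would be \<open>aaa\<close> or \<open>ccc\<close>.\<close>

lemma colour_label_no_cycle:
  assumes "i < 3" "j < 3" "k < 3" "i \<noteq> j" "j \<noteq> k" "k \<noteq> i"
  shows "\<not> cycle51 (colour_label i j True) (colour_label j k True) (colour_label k i True)"
  using assms
  by (elim less_3_cases; hypsubst; (simp only: colour_label_simps)?; simp)

text \<open>Between two different colours the two orders yield the two labels \<open>At_a\<close>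
  and \<open>At_c\<close>, so the label determines the order.\<close>

lemma colour_label_flip:
  assumes "i < 3" "j < 3" "i \<noteq> j" "x = At_a \<or> x = At_c"
  shows "x = colour_label j i True \<longleftrightarrow> x \<noteq> colour_label i j True"
  using assms
  by (elim less_3_cases disjE; hypsubst; (simp only: colour_label_simps)?; simp)

lemma colour_label_ac:
  "i \<noteq> j \<Longrightarrow> colour_label i j b = At_a \<or> colour_label i j b = At_c"
  by (simp add: colour_label_def)

text \<open>Labels are bare atoms here instead of singletons. \<open>four_classes\<close> collects
  what avoiding \<open>net1\<close>, \<open>net2\<close> and \<open>net3\<close> gives, and
  \<open>alternating_square\<close> is \<open>net4\<close>. Distinct vertices may still be labelled
  \<open>At_Id\<close>.\<close>

locale avoiding_labelling =
  fixes V :: "nat set" and l :: "nat \<Rightarrow> nat \<Rightarrow> atom51"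
  assumes finite: "finite V"
    and refl: "x \<in> V \<Longrightarrow> l x x = At_Id"
    and triangle: "x \<in> V \<Longrightarrow> y \<in> V \<Longrightarrow> z \<in> V \<Longrightarrow> cycle51 (l x z) (l z y) (l x y)"
    and four_classes: "p \<in> V \<Longrightarrow> q \<in> V \<Longrightarrow> r \<in> V \<Longrightarrow> s \<in> V \<Longrightarrow>
      l p q = At_a \<or> l p q = At_c \<Longrightarrow> l p r = At_a \<or> l p r = At_c \<Longrightarrow>
      l p s = At_a \<or> l p s = At_c \<Longrightarrow> l q r = At_a \<or> l q r = At_c \<Longrightarrow>
      l q s = At_a \<or> l q s = At_c \<Longrightarrow> l r s = At_a \<or> l r s = At_c \<Longrightarrow> False"
    and alternating_square: "p \<in> V \<Longrightarrow> q \<in> V \<Longrightarrow> r \<in> V \<Longrightarrow> s \<in> V \<Longrightarrow>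
      l p q = At_b \<Longrightarrow> l r s = At_b \<Longrightarrow> l p r = At_a \<Longrightarrow> l q s = At_a \<Longrightarrow>
      l p s = At_c \<Longrightarrow> l q r = At_c \<Longrightarrow> False"
begin

text \<open>Apply \<open>triangle\<close> to the loop at \<open>x\<close>: \<open>At_Id\<close> lies
  only in the composition of an atom with itself.\<close>

lemma sym: "x \<in> V \<Longrightarrow> y \<in> V \<Longrightarrow> l x y = l y x"
  using triangle[of x x y] refl[of x] by (cases "l x y"; cases "l y x"; simp)

lemma Id_subst: "x \<in> V \<Longrightarrow> y \<in> V \<Longrightarrow> z \<in> V \<Longrightarrow> l x y = At_Id \<Longrightarrow> l x z = l y z"
  using triangle[of x z y] by simp

definition same :: "nat \<Rightarrow> nat \<Rightarrow> bool" where
  "same x y \<longleftrightarrow> l x y = At_Id \<or> l x y = At_b"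

lemma same_sym: "x \<in> V \<Longrightarrow> y \<in> V \<Longrightarrow> same x y \<longleftrightarrow> same y x"
  using sym[of x y] by (simp add: same_def)

lemma same_trans:
  "x \<in> V \<Longrightarrow> y \<in> V \<Longrightarrow> z \<in> V \<Longrightarrow> same x y \<Longrightarrow> same y z \<Longrightarrow> same x z"
  unfolding same_def using triangle[of x z y] by (cases "l x z") auto

lemma not_same: "\<not> same x y \<longleftrightarrow> l x y = At_a \<or> l x y = At_c"
  unfolding same_def by (cases "l x y") auto

text \<open>\<open>p\<close> represents one class, \<open>q\<close> a second one, and all remaining
  vertices receive colour 2. Two of these in different classes would form four classes together with
  \<open>p\<close> and \<open>q\<close>.\<close>

lemma three_colouring:
  obtains col :: "nat \<Rightarrow> nat"
  where "\<forall>x. col x < 3" "\<forall>x\<in>V. \<forall>y\<in>V. col x = col y \<longleftrightarrow> same x y"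
proof -
  define p where "p = (SOME p. p \<in> V)"
  \<comment> \<open>If there is only one class, \<open>q\<close> is an arbitrary value; then every
    vertex of \<open>V\<close> has colour 0.\<close>
  define q where "q = (SOME q. q \<in> V \<and> \<not> same p q)"
  define col :: "nat \<Rightarrow> nat" where
    "col x = (if same p x then 0 else if same q x then 1 else 2)" for x
  have p: "p \<in> V" if "x \<in> V" for x
    unfolding p_def using that by (rule someI)
  have q: "q \<in> V \<and> \<not> same p q" if "x \<in> V" "\<not> same p x" for x
    unfolding q_def using that by (intro someI[of "\<lambda>q. q \<in> V \<and> \<not> same p q" x]) simp
  have "col x = col y \<longleftrightarrow> same x y" if x: "x \<in> V" and y: "y \<in> V" for x y
  proof
    assume "same x y"
    have "same z x \<longleftrightarrow> same z y" if "z \<in> V" for z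
      using same_trans[OF that x y] same_trans[OF that y x] same_sym[OF x y] \<open>same x y\<close> by blast
    then have "same p x \<longleftrightarrow> same p y" "\<not> same p x \<Longrightarrow> same q x \<longleftrightarrow> same q y"
      using p[OF x] q[OF x] by simp_all
    then show "col x = col y" by (simp add: col_def)
  next
    assume eq: "col x = col y"
    have via: "same x y" if "z \<in> V" "same z x" "same z y" for z
      using same_trans[OF x that(1) y] same_sym[OF x that(1)] that(2,3) by simp
    consider "same p x" "same p y" | "\<not> same p x" "same q x" "same q y"
      | "\<not> same p x" "\<not> same p y" "\<not> same q x" "\<not> same q y"
      using eq unfolding col_def by (auto split: if_splits)
    then show "same x y"
    proof cases
      case 1
      then show ?thesis by (intro via[of p] p[OF x])
    next
      case 2
      then show ?thesis using q[OF x] by (intro via[of q]) simp_all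
    next
      case 3
      with q[OF x] p[OF x] x y show ?thesis
        using four_classes[of p q x y, folded not_same] by argo
    qed
  qed
  then show thesis by (intro that[of col]) (simp_all add: col_def)
qed

section \<open>The order forced between colour classes\<close>

context
  fixes col :: "nat \<Rightarrow> nat"
  assumes col_less: "\<And>x. col x < 3"
    and col_eq: "\<And>x y. x \<in> V \<Longrightarrow> y \<in> V \<Longrightarrow> col x = col y \<longleftrightarrow> same x y"
begin

text \<open>These are the comparisons that positions must respect; pairs of equal colour are joined
  by \<open>At_b\<close> or \<open>At_Id\<close> and impose none.\<close>

definition before :: "nat \<Rightarrow> nat \<Rightarrow> bool" where
  "before x y \<longleftrightarrow> x \<in> V \<and> y \<in> V \<and> col x \<noteq> col y \<and> l x y = colour_label (col x) (col y) True"

text \<open>Between different colours \<open>before\<close> is thus a tournament: each of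
  \<open>At_a\<close> and \<open>At_c\<close> is the forward label in exactly one direction.\<close>

lemma before_flip:
  assumes "x \<in> V" "y \<in> V" "col x \<noteq> col y"
  shows "before y x \<longleftrightarrow> \<not> before x y"
proof -
  have "l x y = At_a \<or> l x y = At_c"
    using assms col_eq not_same by simp
  from colour_label_flip[OF col_less col_less assms(3) this]
  show ?thesis unfolding before_def using assms sym[of x y] by simp
qed

lemma label_before:
  assumes "x \<in> V" "y \<in> V" "col x \<noteq> col y"
  shows "l x y = colour_label (col x) (col y) (before x y)"
proof (cases "before x y")
  case True
  then show ?thesis by (simp add: before_def)
next
  case False
  then have "l y x = colour_label (col y) (col x) True"
    using before_flip[OF assms] by (simp add: before_def)
  then show ?thesis
    using False sym[OF assms(1,2)] colour_label_sym[OF col_less col_less, of y x True] by simp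
qed

lemma before_D: "before x y \<Longrightarrow> x \<in> V" "before x y \<Longrightarrow> y \<in> V" "before x y \<Longrightarrow> col x \<noteq> col y"
  by (simp_all add: before_def)

text \<open>Consecutive vertices differ in colour, so all three colours occur and the sides would be
  \<open>aaa\<close> or \<open>ccc\<close>.\<close>

lemma no_3_cycle:
  assumes uv: "before u v" and vw: "before v w" and wu: "before w u"
  shows False
proof -
  have "cycle51 (l u v) (l v w) (l w u)"
    using triangle[of u w v] sym[of u w] before_D uv vw by simp
  then show False
    using colour_label_no_cycle[OF col_less col_less col_less, of u v w] uv vw wu
    by (simp add: before_def)
qed

text \<open>Alternating colours make the labels along the cycle alternate between
  \<open>At_a\<close> and \<open>At_c\<close>. The diagonals stay within classes, and a diagonal
  \<open>At_Id\<close> would equate two different sides at its ends. So both diagonals are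
  \<open>At_b\<close>, which gives \<open>net4\<close>.\<close>

lemma no_4_cycle:
  assumes uv: "before u v" and vw: "before v w" and wx: "before w x" and xu: "before x u"
    and cols: "col u = col w" "col v = col x"
  shows False
proof -
  note V = before_D(1)[OF uv] before_D(1)[OF vw] before_D(1)[OF wx] before_D(1)[OF xu]
  define f where "f = colour_label (col u) (col v) True"
  define g where "g = colour_label (col v) (col u) True"
  have l: "l u v = f" "l v w = g" "l w x = f" "l x u = g"
    using uv vw wx xu cols by (simp_all add: before_def f_def g_def)
  then have l': "l w v = g" "l u x = g"
    using sym V by simp_all
  have ne: "col u \<noteq> col v" by (rule before_D(3)[OF uv])
  have f: "f = At_a \<or> f = At_c" unfolding f_def by (rule colour_label_ac[OF ne])
  have g: "g = At_a \<or> g = At_c" unfolding g_def by (rule colour_label_ac[OF ne[symmetric]])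
  have fg: "f \<noteq> g"
    using colour_label_flip[OF col_less col_less ne f] by (simp add: f_def g_def)
  have "l u w \<noteq> At_Id"
    using Id_subst[of u w v] V l l' fg by auto
  then have uw: "l u w = At_b"
    using col_eq[of u w] cols V by (simp add: same_def)
  have "l v x \<noteq> At_Id"
    using Id_subst[of v x u] V l l' fg sym[of u v] by auto
  then have vx: "l v x = At_b"
    using col_eq[of v x] cols V by (simp add: same_def)
  then have xv: "l x v = At_b" using sym V by simp
  show False
  \<comment> \<open>The cases differ in the direction of the second diagonal, chosen so that the
    \<open>At_a\<close>-sides are the pairs \<open>p r\<close> and \<open>q s\<close>.\<close>
  proof (cases "f = At_a")
    case True
    then have "g = At_c" using g fg by auto
    with True show False
      using alternating_square[of u w v x] V uw vx l l' by simp
  next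
    case False
    then have "f = At_c" "g = At_a" using f g fg by auto
    then show False
      using alternating_square[of u w x v] V uw xv l l' by simp
  qed
qed

text \<open>Hence \<open>before\<close> together with its square is a transitive relation.\<close>

lemma before_shortcut:
  assumes uv: "before u v" and vw: "before v w" and wx: "before w x"
  shows "before u x \<or> (\<exists>y. before u y \<and> before y x)"
proof (cases "col u = col w")
  case False
  then have "before u w"
    using no_3_cycle[OF uv vw] before_flip before_D(1)[OF uv] before_D(1)[OF wx] by blast
  with wx show ?thesis by blast
next
  case True
  then have ux: "col u \<noteq> col x" using before_D(3)[OF wx] by simp
  have "before u x"
  proof (rule ccontr)
    assume "\<not> before u x"
    then have xu: "before x u"
      using before_flip[OF before_D(1)[OF uv] before_D(2)[OF wx] ux] by simp
    \<comment> \<open>Otherwise \<open>v\<close> and \<open>x\<close> are comparable, and this chord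
      closes a 3-cycle with \<open>u\<close> or with \<open>w\<close>.\<close>
    have "col v = col x"
    proof (rule ccontr)
      assume "col v \<noteq> col x"
      then have "before v x \<or> before x v"
        using before_flip[OF before_D(1)[OF vw] before_D(2)[OF wx]] by blast
      then show False
        using no_3_cycle[OF uv _ xu] no_3_cycle[OF vw wx] by blast
    qed
    with True show False using no_4_cycle[OF uv vw wx xu] by simp
  qed
  then show ?thesis ..
qed

text \<open>The transitive closure of \<open>before\<close>: by \<open>before_shortcut\<close>,
  paths of length at most two suffice.\<close>

definition precedes :: "nat \<Rightarrow> nat \<Rightarrow> bool" where
  "precedes x y \<longleftrightarrow> before x y \<or> (\<exists>z. before x z \<and> before z y)"

lemma precedes_before:
  assumes "precedes x y" "before y z"
  shows "precedes x z"
proof -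
  consider "before x y" | w where "before x w" "before w y"
    using assms(1) unfolding precedes_def by blast
  then show ?thesis
  proof cases
    case 1
    with assms(2) show ?thesis unfolding precedes_def by blast
  next
    case 2
    with before_shortcut[OF 2 assms(2)] show ?thesis unfolding precedes_def by blast
  qed
qed

definition rank :: "nat \<Rightarrow> nat" where
  "rank x = card {w \<in> V. precedes w x}"

text \<open>Predecessors of \<open>x\<close> are predecessors of \<open>y\<close>, and
  \<open>x\<close> is a new one: \<open>precedes x x\<close> would be a loop or a 2-cycle of
  \<open>before\<close>.\<close>

lemma rank_less:
  assumes "before x y"
  shows "rank x < rank y"
  unfolding rank_def
proof (rule psubset_card_mono)
  show "finite {w \<in> V. precedes w y}" using finite by simp
  have "\<not> precedes x x"
  proof
    assume "precedes x x"
    then consider "before x x" | z where "before x z" "before z x"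
      unfolding precedes_def by blast
    then show False
    proof cases
      case 1
      then show False using before_D(3) by blast
    next
      case 2
      then show False using before_flip[of x z] before_D[OF 2(1)] by blast
    qed
  qed
  moreover have "precedes x y" using assms by (simp add: precedes_def)
  moreover have "precedes w y" if "precedes w x" for w
    using precedes_before[OF that assms] .
  ultimately show "{w \<in> V. precedes w x} \<subset> {w \<in> V. precedes w y}"
    using before_D(1)[OF assms] by blast
qed

text \<open>List the vertices by \<open>rank\<close>, which extends \<open>before\<close> to
  positions, and use density to place them in this order with their colours. Vertices joined by
  \<open>At_Id\<close> are first merged.\<close>

lemma embeds_in_coloured_order_aux:
  fixes pos :: "'v \<Rightarrow> real" and col' :: "'v \<Rightarrow> nat"
  assumes dense: "\<And>p q i. p < q \<Longrightarrow> i < 3 \<Longrightarrow> \<exists>n. col' n = i \<and> p < pos n \<and> pos n < q"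
  shows "\<exists>s. \<forall>x\<in>V. \<forall>y\<in>V. l x y =
    (if s x = s y then At_Id else colour_label (col' (s x)) (col' (s y)) (pos (s x) < pos (s y)))"
proof -
  obtain M where M: "\<forall>x\<in>V. x < M"
    using finite unfolding finite_nat_set_iff_bounded by (elim exE)
  \<comment> \<open>As \<open>M\<close> bounds the vertices, \<open>t\<close> orders them
    lexicographically by rank and then by number; on \<open>V\<close> it is injective.\<close>
  define t where "t x = rank x * M + x" for x
  have t_less: "t x < t y" if "rank x < rank y" "x \<in> V" for x y
  proof -
    have "t x < rank x * M + M" using M that(2) by (simp add: t_def)
    also have "\<dots> = Suc (rank x) * M" by simp
    also have "\<dots> \<le> rank y * M" using that(1) by (intro mult_le_mono1) simp
    finally show ?thesis by (simp add: t_def)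
  qed
  have t_inj: "x = y" if "t x = t y" "x \<in> V" "y \<in> V" for x y
    using t_less[of x y] t_less[of y x] that by (cases "rank x" "rank y" rule: linorder_cases) (auto simp: t_def)
  \<comment> \<open>The open unit intervals above different values of \<open>t\<close> are disjoint,
    so positions inherit the order of \<open>t\<close>.\<close>
  have "\<exists>n. col' n = col x \<and> real (t x) < pos n \<and> pos n < real (t x) + 1" for x
    by (rule dense) (simp_all add: col_less)
  then obtain g where g: "\<And>x. col' (g x) = col x" "\<And>x. real (t x) < pos (g x)"
      "\<And>x. pos (g x) < real (t x) + 1"
    by metis
  have pos_less: "pos (g x) < pos (g y)" if "t x < t y" for x y
  proof -
    have "real (t x) + 1 \<le> real (t y)" using that by linarith
    with g(3)[of x] g(2)[of y] show ?thesis by linarith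
  qed
  define e where "e u v =
    (if u = v then At_Id else colour_label (col' u) (col' v) (pos u < pos v))" for u v
  have g_eq: "e (g x) (g y) = l x y" if x: "x \<in> V" and y: "y \<in> V" and ne: "l x y \<noteq> At_Id" for x y
  proof -
    have "t x \<noteq> t y" using t_inj[OF _ x y] refl[OF x] ne by blast
    then have "g x \<noteq> g y"
      using pos_less[of x y] pos_less[of y x] by (cases "t x" "t y" rule: linorder_cases) auto
    then have e: "e (g x) (g y) = colour_label (col x) (col y) (pos (g x) < pos (g y))"
      by (simp add: e_def g(1))
    show ?thesis
    proof (cases "col x = col y")
      case True
      then have "l x y = At_b" using col_eq[OF x y] ne by (simp add: same_def)
      with e True show ?thesis by (simp add: colour_label_def)
    next
      case False
      have "pos (g x) < pos (g y) \<longleftrightarrow> before x y"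
      proof
        assume "before x y"
        then show "pos (g x) < pos (g y)"
          by (intro pos_less t_less rank_less x)
      next
        assume less: "pos (g x) < pos (g y)"
        show "before x y"
        proof (rule ccontr)
          assume "\<not> before x y"
          then have "before y x" using before_flip[OF x y False] by simp
          then have "pos (g y) < pos (g x)"
            by (intro pos_less t_less rank_less y)
          with less show False by simp
        qed
      qed
      with e label_before[OF x y False] show ?thesis by simp
    qed
  qed
  \<comment> \<open>Since \<open>g\<close> separates the vertices of \<open>V\<close>, those joined
    by \<open>At_Id\<close> are replaced by the least vertex among them.\<close>
  define \<rho> where "\<rho> x = (LEAST y. y \<in> V \<and> l x y = At_Id)" for x
  have \<rho>: "\<rho> x \<in> V \<and> l x (\<rho> x) = At_Id" if "x \<in> V" for x
    unfolding \<rho>_def by (rule LeastI[of _ x]) (simp add: that refl)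
  have \<rho>_eq: "\<rho> x = \<rho> y" if x: "x \<in> V" and y: "y \<in> V" and "l x y = At_Id" for x y
  proof -
    have "(\<lambda>z. z \<in> V \<and> l x z = At_Id) = (\<lambda>z. z \<in> V \<and> l y z = At_Id)"
      using Id_subst[OF x y _ that(3)] by auto
    then show ?thesis by (simp add: \<rho>_def)
  qed
  have l_\<rho>: "l x y = l (\<rho> x) (\<rho> y)" if x: "x \<in> V" and y: "y \<in> V" for x y
  proof -
    have "l x y = l (\<rho> x) y" using Id_subst[of x "\<rho> x" y] \<rho>[OF x] x y by simp
    also have "\<dots> = l y (\<rho> x)" using sym \<rho>[OF x] y by simp
    also have "\<dots> = l (\<rho> y) (\<rho> x)" using Id_subst[of y "\<rho> y" "\<rho> x"] \<rho>[OF x] \<rho>[OF y] y by simp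
    also have "\<dots> = l (\<rho> x) (\<rho> y)" using sym \<rho>[OF x] \<rho>[OF y] by simp
    finally show ?thesis .
  qed
  have "e (g (\<rho> x)) (g (\<rho> y)) = l x y" if x: "x \<in> V" and y: "y \<in> V" for x y
  proof (cases "l x y = At_Id")
    case True
    then show ?thesis using \<rho>_eq[OF x y] by (simp add: e_def)
  next
    case False
    then show ?thesis using g_eq[of "\<rho> x" "\<rho> y"] \<rho>[OF x] \<rho>[OF y] l_\<rho>[OF x y] by simp
  qed
  then show ?thesis
    unfolding e_def by (intro exI[of _ "\<lambda>x. g (\<rho> x)"]) simp
qed

end

lemma embeds_in_coloured_order:
  fixes pos :: "'v \<Rightarrow> real" and col :: "'v \<Rightarrow> nat"
  assumes "\<And>p q i. p < q \<Longrightarrow> i < 3 \<Longrightarrow> \<exists>n. col n = i \<and> p < pos n \<and> pos n < q"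
  shows "\<exists>s. \<forall>x\<in>V. \<forall>y\<in>V. l x y =
    (if s x = s y then At_Id else colour_label (col (s x)) (col (s y)) (pos (s x) < pos (s y)))"
proof -
  obtain c :: "nat \<Rightarrow> nat" where c: "\<forall>x. c x < 3" "\<forall>x\<in>V. \<forall>y\<in>V. c x = c y \<longleftrightarrow> same x y"
    by (rule three_colouring)
  show ?thesis
    using c assms by (intro embeds_in_coloured_order_aux[of c]) simp_all
qed

end

section \<open>From avoiding networks to avoiding labellings\<close>

lemma atomic_label:
  fixes N :: "(atom51 set, 'v) network"
  assumes "atomic N" "x \<in> verts N" "y \<in> verts N"
  shows "label N x y = {the_elem (label N x y)}"
proof -
  have "is_atom (label N x y)" using assms unfolding atomic_def by simp
  then have "\<exists>z. label N x y = {z}" by (simp only: is_atom_atom51_set)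
  then obtain z where "label N x y = {z}" by (elim exE)
  then show ?thesis by simp
qed

lemma avoiding_labelling_of_network:
  fixes N :: "(atom51 set, nat) network"
  assumes "is_network N" and atomic: "atomic N" and cons: "consistent ra51_65 N"
    and avoids: "avoids N net1" "avoids N net2" "avoids N net3" "avoids N net4"
  shows "avoiding_labelling (verts N) (\<lambda>x y. the_elem (label N x y))"
proof -
  define l where "l x y = the_elem (label N x y)" for x y
  have l: "label N x y = {l x y}" if "x \<in> verts N" "y \<in> verts N" for x y
    unfolding l_def using atomic that by (rule atomic_label)
  have refl: "l x x = At_Id" if "x \<in> verts N" for x
  proof -
    have "label N x x \<le> rel_id ra51_65" using cons that unfolding consistent_def by simp
    with l[OF that that] show ?thesis by (simp add: ra51_65_def)
  qed
  have triangle: "cycle51 (l x z) (l z y) (l x y)"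
    if x: "x \<in> verts N" and y: "y \<in> verts N" and z: "z \<in> verts N" for x y z
  proof -
    have "label N x y \<le> rel_comp ra51_65 (label N x z) (label N z y)"
      using cons x y z unfolding consistent_def by simp
    then show ?thesis using l x y z by (simp add: ra51_65_def)
  qed
  have sym: "l x y = l y x" if "x \<in> verts N" "y \<in> verts N" for x y
    using triangle[of x x y] refl[of x] that by (cases "l x y"; cases "l y x"; simp)
  have forbidden: "\<not> (l p q = g {0, 1} \<and> l p r = g {0, 2} \<and> l p s = g {0, 3} \<and>
      l q r = g {1, 2} \<and> l q s = g {1, 3} \<and> l r s = g {2, 3})"
    if g: "avoids N (sym_network4 g)" "At_Id \<notin> g ` {{0, 1}, {0, 2}, {0, 3}, {1, 2}, {1, 3}, {2, 3}}"
      and V: "p \<in> verts N" "q \<in> verts N" "r \<in> verts N" "s \<in> verts N" for g p q r s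
  proof
    assume *: "l p q = g {0, 1} \<and> l p r = g {0, 2} \<and> l p s = g {0, 3} \<and>
      l q r = g {1, 2} \<and> l q s = g {1, 3} \<and> l r s = g {2, 3}"
    have V': "x \<in> verts N" if "x \<in> {p, q, r, s}" for x using that V by auto
    have "\<not> avoids N (sym_network4 g)"
    proof (rule not_avoids_sym_network4I[OF _ _ _ _ _ _ _ _ _ g(2)])
      show "{p, q, r, s} \<subseteq> verts N" using V by simp
      show "label N x x = {At_Id}" if "x \<in> {p, q, r, s}" for x
        using V'[OF that] l refl by simp
      show "label N x y = label N y x" if "x \<in> {p, q, r, s}" "y \<in> {p, q, r, s}" for x y
        using V'[OF that(1)] V'[OF that(2)] l sym by simp
    qed (use * V l in simp_all)
    with g(1) show False by simp
  qed
  have n1: "\<not> (l p q = At_a \<and> l p r = At_c \<and> l p s = At_a \<and> l q r = At_a \<and> l q s = At_c \<and> l r s = At_a)"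
    if "p \<in> verts N" "q \<in> verts N" "r \<in> verts N" "s \<in> verts N" for p q r s
    using forbidden[OF avoids(1)[unfolded net1_def] _ that] by (simp add: doubleton_eq_iff)
  have n2: "\<not> (l p q = At_c \<and> l p r = At_a \<and> l p s = At_c \<and> l q r = At_c \<and> l q s = At_a \<and> l r s = At_c)"
    if "p \<in> verts N" "q \<in> verts N" "r \<in> verts N" "s \<in> verts N" for p q r s
    using forbidden[OF avoids(2)[unfolded net2_def] _ that] by (simp add: doubleton_eq_iff)
  have n3: "\<not> (l p q = At_a \<and> l p r = At_c \<and> l p s = At_c \<and> l q r = At_a \<and> l q s = At_c \<and> l r s = At_a)"
    if "p \<in> verts N" "q \<in> verts N" "r \<in> verts N" "s \<in> verts N" for p q r s
    using forbidden[OF avoids(3)[unfolded net3_def] _ that] by (simp add: doubleton_eq_iff)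
  have n4: "\<not> (l p q = At_b \<and> l p r = At_a \<and> l p s = At_c \<and> l q r = At_c \<and> l q s = At_a \<and> l r s = At_b)"
    if "p \<in> verts N" "q \<in> verts N" "r \<in> verts N" "s \<in> verts N" for p q r s
    using forbidden[OF avoids(4)[unfolded net4_def] _ that] by (simp add: doubleton_eq_iff)
  have False
    if V: "p \<in> verts N" "q \<in> verts N" "r \<in> verts N" "s \<in> verts N"
      and ac: "l p q = At_a \<or> l p q = At_c" "l p r = At_a \<or> l p r = At_c"
        "l p s = At_a \<or> l p s = At_c" "l q r = At_a \<or> l q r = At_c"
        "l q s = At_a \<or> l q s = At_c" "l r s = At_a \<or> l r s = At_c" for p q r s
  proof -
    note syms = sym[OF V(2) V(1)] sym[OF V(3) V(1)] sym[OF V(4) V(1)]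
      sym[OF V(3) V(2)] sym[OF V(4) V(2)] sym[OF V(4) V(3)]
    note triangles = triangle[OF V(1,3,2)] triangle[OF V(1,4,2)] triangle[OF V(1,4,3)]
      triangle[OF V(2,4,3)]
    \<comment> \<open>Without a monochromatic triangle, a colouring of the six edges by
      \<open>At_a\<close> and \<open>At_c\<close> is a 4-cycle against a matching, in 3 positions
      for either colour of the cycle, or a path against a path, in 12 positions. All 18 are
      instances of the forbidden networks.\<close>
    note cycles = n1[OF V(1,2,3,4)] n1[OF V(1,3,2,4)] n1[OF V(1,2,4,3)]
      n2[OF V(1,2,3,4)] n2[OF V(1,3,2,4)] n2[OF V(1,2,4,3)]
    note paths = n3[OF V(1,2,3,4)] n3[OF V(1,2,4,3)] n3[OF V(1,3,2,4)] n3[OF V(1,3,4,2)]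
      n3[OF V(1,4,2,3)] n3[OF V(1,4,3,2)] n3[OF V(2,1,3,4)] n3[OF V(2,1,4,3)]
      n3[OF V(2,3,1,4)] n3[OF V(2,4,1,3)] n3[OF V(3,1,2,4)] n3[OF V(3,2,1,4)]
    show False
      using ac triangles cycles paths unfolding syms
      by (elim disjE; simp)
  qed
  then have "avoiding_labelling (verts N) l"
    using \<open>is_network N\<close> refl triangle n4 unfolding is_network_def
    by unfold_locales blast+
  then show ?thesis unfolding l_def .
qed

lemma satisfiable_in_coloured_order:
  fixes N :: "(atom51 set, nat) network" and pos :: "'v \<Rightarrow> real"
  assumes dense: "\<And>p q i. p < q \<Longrightarrow> i < 3 \<Longrightarrow> \<exists>n. col n = i \<and> p < pos n \<and> pos n < q"
    and "is_network N" and atomic: "atomic N" and "consistent ra51_65 N"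
    and "avoids N net1" "avoids N net2" "avoids N net3" "avoids N net4"
  shows "satisfiable_in N (coloured_order pos col)"
proof -
  define l where "l x y = the_elem (label N x y)" for x y
  interpret avoiding_labelling "verts N" l
    unfolding l_def by (intro avoiding_labelling_of_network assms)
  obtain s where s: "\<forall>x\<in>verts N. \<forall>y\<in>verts N. l x y =
      (if s x = s y then At_Id else colour_label (col (s x)) (col (s y)) (pos (s x) < pos (s y)))"
    using embeds_in_coloured_order[of col pos, OF dense] by auto
  have "(s x, s y) \<in> interp (coloured_order pos col) (label N x y)"
    if "x \<in> verts N" "y \<in> verts N" for x y
  proof -
    have "label N x y = {l x y}"
      unfolding l_def using atomic that by (rule atomic_label)
    with s that show ?thesis by (simp add: coloured_order_def)
  qed
  then show ?thesis
    unfolding satisfiable_in_def by (intro exI[of _ s]) (simp add: coloured_order_def)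
qed

section \<open>Finite boundedness and universality\<close>

lemma embeds_trans:
  assumes "embeds C D" "embeds D E"
  shows "embeds C E"
proof -
  obtain f where f: "f ` universe C \<subseteq> universe D" "inj_on f (universe C)"
    "\<forall>a. \<forall>u\<in>universe C. \<forall>v\<in>universe C. (u, v) \<in> interp C a \<longleftrightarrow> (f u, f v) \<in> interp D a"
    using assms(1) unfolding embeds_def by (elim exE conjE)
  obtain g where g: "g ` universe D \<subseteq> universe E" "inj_on g (universe D)"
    "\<forall>a. \<forall>u\<in>universe D. \<forall>v\<in>universe D. (u, v) \<in> interp D a \<longleftrightarrow> (g u, g v) \<in> interp E a"
    using assms(2) unfolding embeds_def by (elim exE conjE)
  have fD: "f u \<in> universe D" if "u \<in> universe C" for u
    using f(1) that by (rule subsetD[OF _ imageI])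
  show ?thesis
    unfolding embeds_def
  proof (intro exI[of _ "g \<circ> f"] conjI allI ballI)
    show "(g \<circ> f) ` universe C \<subseteq> universe E"
      using g(1) fD by (simp add: image_subset_iff)
    show "inj_on (g \<circ> f) (universe C)"
      using f(1,2) g(2) by (intro comp_inj_on inj_on_subset[OF g(2)])
    show "(u, v) \<in> interp C a \<longleftrightarrow> ((g \<circ> f) u, (g \<circ> f) v) \<in> interp E a"
      if "u \<in> universe C" "v \<in> universe C" for a u v
      using f(3) g(3) fD[OF that(1)] fD[OF that(2)] that by simp
  qed
qed

section \<open>Finite boundedness from small substructures\<close>

definition substructure :: "('a, 'v) rel_structure \<Rightarrow> 'v set \<Rightarrow> ('a, 'v) rel_structure" where
  "substructure C K = \<lparr>universe = K, interp = \<lambda>a. interp C a \<inter> K \<times> K\<rparr>"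

lemma finite_UNIV_atom51: "finite (UNIV :: atom51 set)"
proof (rule finite_subset)
  show "UNIV \<subseteq> {At_Id, At_a, At_b, At_c}"
  proof
    fix x show "x \<in> {At_Id, At_a, At_b, At_c}" by (cases x) simp_all
  qed
qed simp

text \<open>The signature, the power set of four atoms, is finite, so each initial segment carries
  finitely many structures.\<close>

lemma finite_bounded_structures:
  "finite {D :: (atom51 set, nat) rel_structure. is_structure D \<and> (\<exists>k\<le>n. universe D = {0..<k})}"
proof (rule finite_subset)
  let ?B = "Pow ({0..<n} \<times> {0..<n})"
  \<comment> \<open>The clause for \<open>a\<close> outside \<open>UNIV\<close> is vacuous; it gives
    the set the shape that \<open>finite_set_of_finite_funs\<close> expects.\<close>
  let ?I = "{i :: atom51 set \<Rightarrow> (nat \<times> nat) set. \<forall>a. (a \<in> UNIV \<longrightarrow> i a \<in> ?B) \<and> (a \<notin> UNIV \<longrightarrow> i a = {})}"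
  have "finite (UNIV :: atom51 set set)"
    unfolding Pow_UNIV[symmetric] using finite_UNIV_atom51 by (rule finite_Pow_iff[THEN iffD2])
  then have "finite ?I"
    by (rule finite_set_of_finite_funs) simp
  then show "finite ((\<lambda>(k, i). \<lparr>universe = {0..<k}, interp = i\<rparr>) ` ({..n} \<times> ?I))"
    by (intro finite_imageI finite_cartesian_product) simp_all
  show "{D. is_structure D \<and> (\<exists>k\<le>n. universe D = {0..<k})}
    \<subseteq> (\<lambda>(k, i). \<lparr>universe = {0..<k}, interp = i\<rparr>) ` ({..n} \<times> ?I)"
  proof
    fix D :: "(atom51 set, nat) rel_structure"
    assume "D \<in> {D. is_structure D \<and> (\<exists>k\<le>n. universe D = {0..<k})}"
    then obtain k where D: "is_structure D" "k \<le> n" "universe D = {0..<k}"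
      by (elim CollectE exE conjE)
    have "interp D a \<subseteq> {0..<n} \<times> {0..<n}" for a
    proof -
      have "interp D a \<subseteq> {0..<k} \<times> {0..<k}"
        using D(1,3) unfolding is_structure_def by simp
      also have "\<dots> \<subseteq> {0..<n} \<times> {0..<n}"
        using D(2) by (intro Sigma_mono) auto
      finally show ?thesis .
    qed
    then have "(k, interp D) \<in> {..n} \<times> ?I" using D(2) by simp
    moreover have "D = \<lparr>universe = {0..<k}, interp = interp D\<rparr>"
      using D(3) by (intro rel_structure.equality) simp_all
    ultimately show "D \<in> (\<lambda>(k, i). \<lparr>universe = {0..<k}, interp = i\<rparr>) ` ({..n} \<times> ?I)"
      by (intro image_eqI[of _ _ "(k, interp D)"]) simp_all
  qed
qed

text \<open>The bounds are the structures on initial segments of size at most \<open>n\<close> that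
  do not embed into \<open>M\<close>. A small substructure of \<open>C\<close> has a copy
  \<open>D\<close> on such a segment; if no bound embeds into \<open>C\<close>, then
  \<open>D\<close> is not a bound and embeds into \<open>M\<close>.\<close>

lemma finitely_bounded_of_local:
  fixes M :: "(atom51 set, 'b) rel_structure"
  assumes local: "\<And>C :: (atom51 set, nat) rel_structure. is_structure C \<Longrightarrow> finite (universe C) \<Longrightarrow>
    (\<And>K. K \<subseteq> universe C \<Longrightarrow> card K \<le> n \<Longrightarrow> embeds (substructure C K) M) \<Longrightarrow> embeds C M"
  shows "finitely_bounded M"
proof -
  define F where "F = {D :: (atom51 set, nat) rel_structure.
    (is_structure D \<and> (\<exists>k\<le>n. universe D = {0..<k})) \<and> \<not> embeds D M}"
  have "finite F"
    unfolding F_def by (rule finite_subset[OF _ finite_bounded_structures[of n]]) blast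
  moreover have "is_structure D \<and> finite (universe D)" if "D \<in> F" for D
    using that unfolding F_def by auto
  moreover have "embeds C M \<longleftrightarrow> \<not> (\<exists>D\<in>F. embeds D C)"
    if C: "is_structure C" "finite (universe C)" for C :: "(atom51 set, nat) rel_structure"
  proof
    assume "embeds C M"
    then show "\<not> (\<exists>D\<in>F. embeds D C)"
      unfolding F_def using embeds_trans by blast
  next
    assume no: "\<not> (\<exists>D\<in>F. embeds D C)"
    show "embeds C M"
    proof (rule local[OF C])
      fix K assume K: "K \<subseteq> universe C" "card K \<le> n"
      have "finite K" using K(1) C(2) by (rule finite_subset)
      then obtain g where g: "bij_betw g {0..<card K} K"
        using ex_bij_betw_nat_finite by blast
      define D :: "(atom51 set, nat) rel_structure" where
        "D = \<lparr>universe = {0..<card K},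
          interp = \<lambda>a. {(i, j). i < card K \<and> j < card K \<and> (g i, g j) \<in> interp C a}\<rparr>"
      have gK: "g i \<in> K" if "i < card K" for i
        using bij_betwE[OF g] that by simp
      have "embeds D C"
        unfolding embeds_def
        using bij_betw_imp_inj_on[OF g] gK K(1) by (intro exI[of _ g]) (auto simp: D_def)
      with no have "D \<notin> F" by blast
      then have "embeds D M"
        unfolding F_def using K(2) by (auto simp: D_def is_structure_def)
      moreover have "embeds (substructure C K) D"
        unfolding embeds_def
      proof (intro exI[of _ "inv_into {0..<card K} g"] conjI allI ballI)
        let ?h = "inv_into {0..<card K} g"
        have h: "bij_betw ?h K {0..<card K}" using g by (rule bij_betw_inv_into)
        show "?h ` universe (substructure C K) \<subseteq> universe D"
          using bij_betw_imp_surj_on[OF h] by (simp add: D_def substructure_def)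
        show "inj_on ?h (universe (substructure C K))"
          using bij_betw_imp_inj_on[OF h] by (simp add: substructure_def)
        show "(u, v) \<in> interp (substructure C K) a \<longleftrightarrow> (?h u, ?h v) \<in> interp D a"
          if "u \<in> universe (substructure C K)" "v \<in> universe (substructure C K)" for a u v
        proof -
          have uv: "u \<in> K" "v \<in> K" using that by (simp_all add: substructure_def)
          moreover have "g (?h u) = u" "g (?h v) = v"
            using bij_betw_inv_into_right[OF g] uv by simp_all
          moreover have "?h u < card K" "?h v < card K"
            using bij_betwE[OF h] uv by simp_all
          ultimately show ?thesis by (simp add: D_def substructure_def)
        qed
      qed
      ultimately show "embeds (substructure C K) M" by (rule embeds_trans[rotated])
    qed
  qed
  ultimately show ?thesis
    unfolding finitely_bounded_def by (intro exI[of _ F]) blast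
qed

text \<open>Squareness puts the pair into the relation of the top element, hence into that of
  exactly one atom.\<close>

lemma square_atom:
  assumes rep: "representation ra51_65 M" and "square M" and "u \<in> universe M" "v \<in> universe M"
  shows "\<exists>x. \<forall>X. (u, v) \<in> interp M X \<longleftrightarrow> x \<in> X"
proof -
  have "(u, v) \<in> interp M UNIV"
    using assms(2-4) by (simp add: square_def)
  then obtain x where x: "(u, v) \<in> interp M {x}"
    unfolding interp_atoms[OF rep, of u v UNIV] by (elim bexE)
  show ?thesis
  proof (intro exI[of _ x] allI)
    show "(u, v) \<in> interp M X \<longleftrightarrow> x \<in> X" for X
      using interp_atom_unique[OF rep x] interp_mono[OF rep, of "{x}" X] x by blast
  qed
qed

lemma avoids_restrict:
  assumes "\<And>W. W \<subseteq> verts N \<Longrightarrow> card W = card (verts P) \<Longrightarrow> avoids \<lparr>verts = W, label = label N\<rparr> P"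
  shows "avoids N P"
  unfolding avoids_def
proof (rule notI, elim exE conjE)
  fix W h
  assume W: "W \<subseteq> verts N" and h: "bij_betw h W (verts P)"
    and l: "\<forall>x\<in>W. \<forall>y\<in>W. label N x y = label P (h x) (h y)"
  have "avoids \<lparr>verts = W, label = label N\<rparr> P"
    using W bij_betw_same_card[OF h] by (rule assms)
  then show False
    unfolding avoids_def using h l by auto
qed

lemma card_forbidden:
  "card (verts net1) = 4" "card (verts net2) = 4" "card (verts net3) = 4" "card (verts net4) = 4"
  by (simp_all add: net1_def net2_def net3_def net4_def sym_network4_def)

text \<open>
  Embeddability in \<open>M\<close> is decided by the substructures with at most four elements, because
  the axioms of atomic consistent networks involve three vertices and the forbidden networks four.
\<close>

lemma finitely_bounded_of_exactly_avoiding: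
  fixes M :: "(atom51 set, 'b) rel_structure"
  assumes rep: "representation ra51_65 M" and sq: "square M" and ex: "satisfies_exactly_avoiding M"
  shows "finitely_bounded M"
proof (rule finitely_bounded_of_local)
  fix C :: "(atom51 set, nat) rel_structure"
  assume fin: "finite (universe C)"
    and small: "\<And>K. K \<subseteq> universe C \<Longrightarrow> card K \<le> 4 \<Longrightarrow> embeds (substructure C K) M"
  have emb: "\<exists>h. h ` K \<subseteq> universe M \<and> inj_on h K \<and>
      (\<forall>a. \<forall>u\<in>K. \<forall>v\<in>K. (u, v) \<in> interp C a \<longleftrightarrow> (h u, h v) \<in> interp M a)"
    if "K \<subseteq> universe C" "card K \<le> 4" for K
    using small[OF that] unfolding embeds_def substructure_def by simp
  \<comment> \<open>Substructures on at most two elements embed into the square \<open>M\<close>, so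
    each pair of \<open>C\<close> is already described by one atom; choosing these atoms makes
    \<open>C\<close> a network.\<close>
  have "\<exists>x. \<forall>X. (u, v) \<in> interp C X \<longleftrightarrow> x \<in> X" if "u \<in> universe C" "v \<in> universe C" for u v
  proof -
    have "card {u, v} \<le> 4" by (rule order_trans[OF card_insert_le_m1[of 2]]) simp_all
    with that obtain h where h: "h ` {u, v} \<subseteq> universe M"
      "\<forall>a. \<forall>u'\<in>{u, v}. \<forall>v'\<in>{u, v}. (u', v') \<in> interp C a \<longleftrightarrow> (h u', h v') \<in> interp M a"
      using emb[of "{u, v}"] by auto
    have "(u, v) \<in> interp C X \<longleftrightarrow> (h u, h v) \<in> interp M X" for X
      using h(2) by simp
    moreover have "\<exists>x. \<forall>X. (h u, h v) \<in> interp M X \<longleftrightarrow> x \<in> X"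
      using h(1) by (intro square_atom[OF rep sq]) simp_all
    ultimately show ?thesis by simp
  qed
  then have "\<forall>u\<in>universe C. \<exists>f. \<forall>v\<in>universe C. \<forall>X. (u, v) \<in> interp C X \<longleftrightarrow> f v \<in> X"
    by (intro ballI bchoice)
  then have "\<exists>l. \<forall>u\<in>universe C. \<forall>v\<in>universe C. \<forall>X. (u, v) \<in> interp C X \<longleftrightarrow> l u v \<in> X"
    by (rule bchoice)
  then obtain l where l: "\<forall>u\<in>universe C. \<forall>v\<in>universe C. \<forall>X. (u, v) \<in> interp C X \<longleftrightarrow> l u v \<in> X"
    by (elim exE)
  define N :: "(atom51 set, nat) network" where
    "N = \<lparr>verts = universe C, label = \<lambda>u v. {l u v}\<rparr>"
  have loc: "\<exists>h. h ` K \<subseteq> universe M \<and> inj_on h K \<and> (\<forall>u\<in>K. \<forall>v\<in>K. (h u, h v) \<in> interp M {l u v})"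
    if K: "K \<subseteq> universe C" "card K \<le> 4" for K
  proof -
    obtain h where h: "h ` K \<subseteq> universe M" "inj_on h K"
      "\<forall>a. \<forall>u\<in>K. \<forall>v\<in>K. (u, v) \<in> interp C a \<longleftrightarrow> (h u, h v) \<in> interp M a"
      using emb[OF K] by (elim exE conjE)
    have "(h u, h v) \<in> interp M {l u v}" if uv: "u \<in> K" "v \<in> K" for u v
    proof -
      have "u \<in> universe C" "v \<in> universe C" using uv K(1) by auto
      with l have "(u, v) \<in> interp C {l u v}" by simp
      with h(3) uv show ?thesis by simp
    qed
    with h(1,2) show ?thesis by (intro exI[of _ h]) simp
  qed
  have Id: "l u v = At_Id \<longleftrightarrow> u = v" if "u \<in> universe C" "v \<in> universe C" for u v
  proof -
    have "card {u, v} \<le> 4" by (rule order_trans[OF card_insert_le_m1[of 2]]) simp_all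
    with that obtain h where h: "h u \<in> universe M" "inj_on h {u, v}" "(h u, h v) \<in> interp M {l u v}"
      using loc[of "{u, v}"] by auto
    have "l u v = At_Id \<longleftrightarrow> h u = h v"
      using interp_Id[OF rep, of "h u" "h v"] interp_atom_unique[OF rep h(3), of "{At_Id}"] h(1,3)
      by auto
    with h(2) show ?thesis by auto
  qed
  have triangle: "cycle51 (l u w) (l w v) (l u v)"
    if "u \<in> universe C" "v \<in> universe C" "w \<in> universe C" for u v w
  proof -
    have "card {u, v, w} \<le> 4"
      by (rule order_trans[OF card_insert_le_m1[of 3]]; simp?)
        (rule order_trans[OF card_insert_le_m1[of 2]]; simp)
    with that obtain h where "(h u, h w) \<in> interp M {l u w}" "(h w, h v) \<in> interp M {l w v}"
        "(h u, h v) \<in> interp M {l u v}"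
      using loc[of "{u, v, w}"] by auto
    then show ?thesis by (rule interp_triangle[OF rep])
  qed
  have "is_network N" using fin by (simp add: is_network_def N_def)
  moreover have "atomic N" by (simp add: atomic_def N_def is_atom_atom51_set)
  moreover have "consistent ra51_65 N"
    using Id triangle by (simp add: consistent_def N_def ra51_65_def)
  \<comment> \<open>Any four vertices embed into \<open>M\<close>, and no network satisfiable in a
    representation contains a forbidden one.\<close>
  moreover have av: "avoids \<lparr>verts = W, label = label N\<rparr> net1 \<and> avoids \<lparr>verts = W, label = label N\<rparr> net2 \<and>
      avoids \<lparr>verts = W, label = label N\<rparr> net3 \<and> avoids \<lparr>verts = W, label = label N\<rparr> net4"
    if W: "W \<subseteq> verts N" "card W = 4" for W
  proof (rule satisfiable_avoids[OF rep])
    show "satisfiable_in \<lparr>verts = W, label = label N\<rparr> M"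
      using loc[of W] W unfolding satisfiable_in_def by (auto simp: N_def)
  qed
  have "avoids N P" if P: "P \<in> {net1, net2, net3, net4}" for P
  proof (rule avoids_restrict)
    fix W assume W: "W \<subseteq> verts N" "card W = card (verts P)"
    with P have "card W = 4" using card_forbidden by auto
    from av[OF W(1) this] P show "avoids \<lparr>verts = W, label = label N\<rparr> P" by auto
  qed
  then have "avoids N net1 \<and> avoids N net2 \<and> avoids N net3 \<and> avoids N net4"
    by simp
  ultimately have "satisfiable_in N M"
    using ex unfolding satisfies_exactly_avoiding_def by simp
  then obtain s where s: "s ` universe C \<subseteq> universe M"
      "\<forall>u\<in>universe C. \<forall>v\<in>universe C. (s u, s v) \<in> interp M {l u v}"
    unfolding satisfiable_in_def by (auto simp: N_def)
  show "embeds C M"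
    unfolding embeds_def
  proof (intro exI[of _ s] conjI allI ballI s(1) inj_onI)
    fix u v assume uv: "u \<in> universe C" "v \<in> universe C"
    have s_uv: "(s u, s v) \<in> interp M {l u v}" using s(2) uv by simp
    {
      \<comment> \<open>Satisfying maps are injective here because equal images force the label
        \<open>At_Id\<close>, which only loops of \<open>C\<close> carry.\<close>
      assume "s u = s v"
      moreover have "s u \<in> universe M" using s(1) uv(1) by auto
      ultimately have "(s u, s v) \<in> interp M {At_Id}"
        using interp_Id[OF rep] by simp
      then have "l u v \<in> {At_Id}" by (rule interp_atom_unique[OF rep s_uv])
      then have "l u v = At_Id" by simp
      with Id uv show "u = v" by simp
    }
    show "(u, v) \<in> interp C a \<longleftrightarrow> (s u, s v) \<in> interp M a" for a
      using l uv interp_atom_unique[OF rep s_uv, of a] interp_mono[OF rep, of "{l u v}" a] s_uv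
      by auto
  qed
qed

text \<open>A solution in any representation selects an atom below each label. The resulting atomic
  network is consistent and avoids the forbidden ones, so it is satisfiable in \<open>M\<close>, and
  its solution there solves the original network.\<close>

lemma universal_of_exactly_avoiding:
  fixes M :: "(atom51 set, 'b) rel_structure"
  assumes rep: "representation ra51_65 M" and ex: "satisfies_exactly_avoiding M"
  shows "universal TYPE('c) ra51_65 M"
  unfolding universal_def
proof (intro conjI rep allI impI, elim conjE)
  fix N :: "(atom51 set, nat) network"
  assume "is_network N" and "satisfiable TYPE('c) ra51_65 N"
  then obtain M' :: "(atom51 set, 'c) rel_structure" where
    rep': "representation ra51_65 M'" and "satisfiable_in N M'"
    unfolding satisfiable_def by (elim exE conjE)
  then obtain s where s: "s ` verts N \<subseteq> universe M'"
    "\<forall>x\<in>verts N. \<forall>y\<in>verts N. (s x, s y) \<in> interp M' (label N x y)"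
    unfolding satisfiable_in_def by (elim exE conjE)
  have "\<forall>x\<in>verts N. \<forall>y\<in>verts N. \<exists>z. z \<in> label N x y \<and> (s x, s y) \<in> interp M' {z}"
    using s(2) interp_atoms[OF rep'] by metis
  then obtain l where l: "\<forall>x\<in>verts N. \<forall>y\<in>verts N. l x y \<in> label N x y \<and> (s x, s y) \<in> interp M' {l x y}"
    by metis
  define N' :: "(atom51 set, nat) network" where "N' = \<lparr>verts = verts N, label = \<lambda>x y. {l x y}\<rparr>"
  have "satisfiable_in N' M'"
    unfolding satisfiable_in_def using s(1) l by (intro exI[of _ s]) (simp add: N'_def)
  then have "avoids N' net1 \<and> avoids N' net2 \<and> avoids N' net3 \<and> avoids N' net4"
    by (rule satisfiable_avoids[OF rep'])
  moreover have "is_network N'" using \<open>is_network N\<close> by (simp add: is_network_def N'_def)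
  moreover have "atomic N'" by (simp add: atomic_def N'_def is_atom_atom51_set)
  moreover have "consistent ra51_65 N'"
  proof -
    have "l x x = At_Id" if x: "x \<in> verts N" for x
    proof -
      have "(s x, s x) \<in> interp M' {l x x}" using l x by simp
      moreover have "(s x, s x) \<in> interp M' {At_Id}"
        unfolding interp_Id[OF rep'] using s(1) x by auto
      ultimately have "l x x \<in> {At_Id}" by (rule interp_atom_unique[OF rep'])
      then show ?thesis by simp
    qed
    moreover have "cycle51 (l x z) (l z y) (l x y)"
      if "x \<in> verts N" "y \<in> verts N" "z \<in> verts N" for x y z
      using l that by (intro interp_triangle[OF rep', of "s x" "s z" _ "s y"]) simp_all
    ultimately show ?thesis
      by (simp add: consistent_def N'_def ra51_65_def)
  qed
  ultimately have "satisfiable_in N' M"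
    using ex unfolding satisfies_exactly_avoiding_def by simp
  then obtain t where t: "t ` verts N \<subseteq> universe M"
    "\<forall>x\<in>verts N. \<forall>y\<in>verts N. (t x, t y) \<in> interp M {l x y}"
    unfolding satisfiable_in_def N'_def by auto
  have "(t x, t y) \<in> interp M (label N x y)" if "x \<in> verts N" "y \<in> verts N" for x y
    using interp_mono[OF rep, of "{l x y}" "label N x y"] l t(2) that by auto
  with t(1) show "satisfiable_in N M"
    unfolding satisfiable_in_def by (intro exI[of _ t]) simp
qed

text \<open>The second conjunct covers every such representation over any vertex type
  \<open>'b\<close>, in particular the one constructed on \<open>nat\<close>; the variable
  \<open>'c\<close> lets the representations that witness satisfiability have any
  cardinality.\<close>

theorem proposition4p25:
  shows "(\<exists>M :: (atom51 set, nat) rel_structure.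
            representation ra51_65 M \<and> square M \<and> satisfies_exactly_avoiding M) \<and>
         (\<forall>M :: (atom51 set, 'b) rel_structure.
            representation ra51_65 M \<and> square M \<and> satisfies_exactly_avoiding M \<longrightarrow>
            finitely_bounded M \<and> universal TYPE('c) ra51_65 M)"
proof
  obtain pos :: "nat \<Rightarrow> real" and col :: "nat \<Rightarrow> nat" where inj: "inj pos" and c: "\<forall>n. col n < 3"
      "\<forall>p q. \<forall>i<3. p < q \<longrightarrow> (\<exists>n. col n = i \<and> p < pos n \<and> pos n < q)"
    by (rule dense_three_coloured_order)
  then have col: "col n < 3"
    and dense: "p < q \<Longrightarrow> i < 3 \<Longrightarrow> \<exists>n. col n = i \<and> p < pos n \<and> pos n < q" for n p q i
    by simp_all
  have rep: "representation ra51_65 (coloured_order pos col)"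
    using inj col dense by (rule representation_coloured_order)
  moreover have "square (coloured_order pos col)"
    by (simp add: square_def coloured_order_def)
  moreover have "satisfies_exactly_avoiding (coloured_order pos col)"
    unfolding satisfies_exactly_avoiding_def
    \<comment> \<open>Avoidance is necessary in every representation; its sufficiency is the
      embedding into the coloured order.\<close>
    using satisfiable_avoids[OF rep] satisfiable_in_coloured_order[OF dense] by blast
  ultimately show "\<exists>M :: (atom51 set, nat) rel_structure.
      representation ra51_65 M \<and> square M \<and> satisfies_exactly_avoiding M"
    by (intro exI conjI)
qed (simp add: finitely_bounded_of_exactly_avoiding universal_of_exactly_avoiding)

end
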